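(* Let $0<M=CC^*\in\mathbb C^{n\times n}$, $0<D=D^*\in\mathbb C^{n\times n}$, and let $G\in\mathbb C^{n\times r}$ have rank $r$. Consider $P(\lambda):=\lambda^2M+\lambda D+GG^*$ and the Hermitian pencil $$S(\lambda):=\lambda\begin{bmatrix} M & 0 \\ 0 & -I_r \end{bmatrix}+\begin{bmatrix} D & G \\ G^* & 0 \end{bmatrix}.$$ Then $P(\lambda)$ is hyperbolic if and only if $S(\lambda)$ is a definite pencil. Moreover, for $\mu\in\mathbb R\setminus\{0\}$, $$\imath(S(\mu))=\imath(P(\mu))+(0,r,0)\quad\text{when }\mu>0,\qquad \imath(S(\mu))=\imath(-P(\mu))+(r,0,0)\quad\text{when }\mu<0.$$
   Context: $A^*$ denotes the conjugate transpose; for Hermitian matrices $X>0$ means positive definite. The inertia of a Hermitian matrix $H$ is $\imath(H):=(\imath_+(H),\imath_-(H),\imath_0(H))$, the numbers of positive, negative and zero eigenvalues of $H$ (with multiplicity). A quadratic matrix polynomial $P(\lambda)=\lambda^2M+\lambda D+K$ with Hermitian coefficients is called hyperbolic if $M>0$ and $(x^*Dx)^2-4(x^*Mx)(x^*Kx)>0$ for all nonzero $x\in\mathbb C^n$ or, equivalently (a known fact), if $M>0$ and $-P(\mu)>0$ for some $\mu\in\mathbb R$. A Hermitian pencil $A+\lambda E$ (with $A,E$ Hermitian) is called definite if $A+\mu E>0$ for some $\mu\in\mathbb R\cup\{\infty\}$, where for $\mu=\infty$ the condition means $E>0$. *)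

theory Defs
  imports
    "Jordan_Normal_Form.Schur_Decomposition"
    "Jordan_Normal_Form.DL_Rank"
    "HOL-Library.Product_Plus"
begin

text \<open>
  On \<^typ>\<open>complex\<close>, the library order makes \<open>0 < z\<close> mean that \<open>z\<close> is real and positive.
\<close>

definition hermitian_mat :: "complex mat \<Rightarrow> bool" where
  "hermitian_mat A \<longleftrightarrow> mat_adjoint A = A"

text \<open>
  The scalar product \<open>u \<bullet>c v\<close> conjugates its second argument, so this is \<open>x\<^sup>* A x\<close>.
\<close>

definition qform :: "complex mat \<Rightarrow> complex vec \<Rightarrow> complex" where
  "qform A x = (A *\<^sub>v x) \<bullet>c x"

definition pos_def :: "complex mat \<Rightarrow> bool" where
  "pos_def A \<longleftrightarrow> hermitian_mat A \<and>
     (\<forall>x \<in> carrier_vec (dim_row A). x \<noteq> 0\<^sub>v (dim_row A) \<longrightarrow> 0 < qform A x)"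

text \<open>
  Eigenvalues are counted with algebraic multiplicity, which is also the geometric one for
  Hermitian matrices.
\<close>

definition inertia :: "complex mat \<Rightarrow> nat \<times> nat \<times> nat" where
  "inertia H =
    (\<Sum>k | eigenvalue H k \<and> k > 0. order k (char_poly H),
     \<Sum>k | eigenvalue H k \<and> k < 0. order k (char_poly H),
     order 0 (char_poly H))"

definition quad_matpoly ::
    "complex mat \<Rightarrow> complex mat \<Rightarrow> complex mat \<Rightarrow> complex \<Rightarrow> complex mat" where
  "quad_matpoly M D K z = z\<^sup>2 \<cdot>\<^sub>m M + z \<cdot>\<^sub>m D + K"

definition pencil :: "complex mat \<Rightarrow> complex mat \<Rightarrow> complex \<Rightarrow> complex mat" where
  "pencil A E z = A + z \<cdot>\<^sub>m E"

text \<open>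
  Hyperbolicity of \<open>z\<^sup>2 M + z D + K\<close> with coefficients of size \<open>n \<times> n\<close>.
\<close>

definition hyperbolic :: "nat \<Rightarrow> complex mat \<Rightarrow> complex mat \<Rightarrow> complex mat \<Rightarrow> bool" where
  "hyperbolic n M D K \<longleftrightarrow>
     M \<in> carrier_mat n n \<and> D \<in> carrier_mat n n \<and> K \<in> carrier_mat n n \<and>
     hermitian_mat M \<and> hermitian_mat D \<and> hermitian_mat K \<and> pos_def M \<and>
     (\<forall>x \<in> carrier_vec n. x \<noteq> 0\<^sub>v n \<longrightarrow>
        0 < (qform D x)\<^sup>2 - 4 * qform M x * qform K x)"

text \<open>
  Definiteness of \<open>A + z E\<close>; the last disjunct is the case \<open>\<mu> = \<infinity>\<close>.
\<close>

definition definite_pencil :: "nat \<Rightarrow> complex mat \<Rightarrow> complex mat \<Rightarrow> bool" where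
  "definite_pencil m A E \<longleftrightarrow>
     A \<in> carrier_mat m m \<and> E \<in> carrier_mat m m \<and> hermitian_mat A \<and> hermitian_mat E \<and>
     ((\<exists>\<mu>::real. pos_def (pencil A E (complex_of_real \<mu>))) \<or> pos_def E)"

end

theory Submission
  imports Defs "Jordan_Normal_Form.Spectral_Radius" "HOL-Analysis.Function_Topology"
begin

text \<open>
  For \<open>\<mu> \<noteq> 0\<close> with sign \<open>\<sigma>\<close>, eliminating the lower right block \<open>-\<mu> I\<close> of \<open>S(\<mu>)\<close> shows that \<open>S(\<mu>)\<close>
  is congruent to \<open>diag(\<sigma> P(\<mu>), -\<sigma> I)\<close>. Sylvester's law of inertia gives the inertia formulas, and
  for \<open>\<mu> < 0\<close> positive definiteness of \<open>S(\<mu>)\<close> is that of \<open>-P(\<mu>)\<close>. It remains to see that a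
  hyperbolic \<open>P\<close> satisfies \<open>-P(\<mu>) > 0\<close> for some \<open>\<mu>\<close>. If \<open>\<lambda>\<^sub>-(x) < \<lambda>\<^sub>+(x)\<close> are the roots of
  \<open>x\<^sup>* P(\<lambda>) x\<close>, then \<open>\<lambda>\<^sub>-(y) < \<lambda>\<^sub>+(x)\<close> for all \<open>x\<close>, \<open>y\<close>: otherwise, at \<open>\<mu> = \<lambda>\<^sub>+(x)\<close>, the form of
  \<open>P'(\<mu>)\<close> changes sign, hence vanishes, somewhere on the set where \<open>P(\<mu>)\<close> is nonnegative, which
  contradicts the positive discriminant. Compactness of the sphere turns this into a gap, any point
  of which is a suitable \<open>\<mu>\<close>; it is negative because \<open>M\<close> and \<open>D\<close> are positive definite and
  \<open>GG\<^sup>*\<close> is positive semidefinite.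
\<close>

section \<open>Adjoints and Hermitian forms\<close>

lemma mat_adjoint_eq:
  "mat_adjoint (A :: complex mat) = mat (dim_col A) (dim_row A) (\<lambda>(i, j). cnj (A $$ (j, i)))"
  by (rule eq_matI) (auto simp: mat_adjoint_def mat_of_rows_index conjugate_vec_def)

lemma dim_mat_adjoint [simp]:
  fixes A :: "complex mat"
  shows "dim_row (mat_adjoint A) = dim_col A" "dim_col (mat_adjoint A) = dim_row A"
  by (simp_all add: mat_adjoint_eq)

lemma index_mat_adjoint [simp]:
  fixes A :: "complex mat"
  shows "i < dim_col A \<Longrightarrow> j < dim_row A \<Longrightarrow> mat_adjoint A $$ (i, j) = cnj (A $$ (j, i))"
  by (simp add: mat_adjoint_eq)

lemma mat_adjoint_carrier [simp]:
  fixes A :: "complex mat"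
  shows "A \<in> carrier_mat n m \<Longrightarrow> mat_adjoint A \<in> carrier_mat m n"
  unfolding carrier_mat_def by simp

lemma mat_adjoint_adjoint [simp]:
  fixes A :: "complex mat"
  shows "mat_adjoint (mat_adjoint A) = A"
  by (rule eq_matI) auto

lemma mat_adjoint_one [simp]: "mat_adjoint (1\<^sub>m n :: complex mat) = 1\<^sub>m n"
  by (rule eq_matI) auto

lemma mat_adjoint_zero [simp]: "mat_adjoint (0\<^sub>m n m :: complex mat) = 0\<^sub>m m n"
  by (rule eq_matI) auto

lemma mat_adjoint_uminus [simp]:
  fixes A :: "complex mat"
  shows "mat_adjoint (- A) = - mat_adjoint A"
  by (rule eq_matI) auto

lemma mat_adjoint_smult [simp]:
  fixes A :: "complex mat"
  shows "mat_adjoint (c \<cdot>\<^sub>m A) = cnj c \<cdot>\<^sub>m mat_adjoint A"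
  by (rule eq_matI) auto

lemma mat_adjoint_add:
  fixes A B :: "complex mat"
  shows "A \<in> carrier_mat n m \<Longrightarrow> B \<in> carrier_mat n m \<Longrightarrow>
    mat_adjoint (A + B) = mat_adjoint A + mat_adjoint B"
  by (rule eq_matI) auto

lemma mat_adjoint_mult:
  fixes A B :: "complex mat"
  assumes "A \<in> carrier_mat n m" "B \<in> carrier_mat m k"
  shows "mat_adjoint (A * B) = mat_adjoint B * mat_adjoint A"
  using assms by (intro eq_matI) (auto simp: scalar_prod_def mult.commute)

lemma mat_adjoint_four_block:
  fixes A B C D :: "complex mat"
  assumes "A \<in> carrier_mat n1 m1" "B \<in> carrier_mat n1 m2"
    "C \<in> carrier_mat n2 m1" "D \<in> carrier_mat n2 m2"
  shows "mat_adjoint (four_block_mat A B C D) =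
    four_block_mat (mat_adjoint A) (mat_adjoint C) (mat_adjoint B) (mat_adjoint D)"
  using assms by (intro eq_matI) auto

section \<open>The complex scalar product and the forms of Hermitian matrices\<close>

lemma cscalar_prod_adjoint:
  fixes A :: "complex mat"
  assumes "A \<in> carrier_mat n m" "x \<in> carrier_vec m" "y \<in> carrier_vec n"
  shows "(A *\<^sub>v x) \<bullet>c y = x \<bullet>c (mat_adjoint A *\<^sub>v y)"
proof -
  have "(A *\<^sub>v x) \<bullet>c y = (\<Sum>i<n. \<Sum>j<m. A $$ (i, j) * x $ j * cnj (y $ i))"
    using assms by (auto simp: scalar_prod_def sum_distrib_right lessThan_atLeast0)
  also have "\<dots> = (\<Sum>j<m. \<Sum>i<n. A $$ (i, j) * x $ j * cnj (y $ i))"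
    by (rule sum.swap)
  also have "\<dots> = x \<bullet>c (mat_adjoint A *\<^sub>v y)"
    using assms by (auto simp: scalar_prod_def sum_distrib_left lessThan_atLeast0 algebra_simps)
  finally show ?thesis .
qed

lemma cscalar_prod_swap:
  fixes x y :: "complex vec"
  assumes "x \<in> carrier_vec n" "y \<in> carrier_vec n"
  shows "y \<bullet>c x = cnj (x \<bullet>c y)"
  using assms by (auto simp: scalar_prod_def mult.commute)

lemma cscalar_prod_self:
  fixes x :: "complex vec"
  assumes "x \<in> carrier_vec n"
  shows "x \<bullet>c x = of_real (\<Sum>i<n. (cmod (x $ i))\<^sup>2)"
  using assms by (auto simp: scalar_prod_def complex_norm_square[symmetric] lessThan_atLeast0)

text \<open>For Hermitian matrices the form is real, so the real part loses nothing and sign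
  arguments can use the linear order of the reals instead of the partial order on
  \<open>complex\<close>.\<close>

definition hform :: "complex mat \<Rightarrow> complex vec \<Rightarrow> real" where
  "hform H x = Re (qform H x)"

lemma qform_hermitian:
  assumes "H \<in> carrier_mat n n" "hermitian_mat H" "x \<in> carrier_vec n"
  shows "qform H x = of_real (hform H x)"
proof -
  have "qform H x = x \<bullet>c (H *\<^sub>v x)"
    using cscalar_prod_adjoint[OF assms(1,3,3)] assms(2) by (simp add: qform_def hermitian_mat_def)
  also have "\<dots> = cnj (qform H x)"
    using cscalar_prod_swap[of "H *\<^sub>v x" n x] assms by (simp add: qform_def)
  finally show ?thesis
    unfolding hform_def by (metis Reals_cnj_iff of_real_Re)
qed

lemma pos_def_iff:
  assumes "H \<in> carrier_mat n n"
  shows "pos_def H \<longleftrightarrow> hermitian_mat H \<and> (\<forall>x\<in>carrier_vec n. x \<noteq> 0\<^sub>v n \<longrightarrow> 0 < hform H x)"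
  using assms qform_hermitian[OF assms] by (auto simp: pos_def_def less_complex_def)

lemma qform_congruence:
  assumes "T \<in> carrier_mat m n" "H \<in> carrier_mat n n" "x \<in> carrier_vec m"
  shows "qform (T * H * mat_adjoint T) x = qform H (mat_adjoint T *\<^sub>v x)"
proof -
  have "(T * H * mat_adjoint T) *\<^sub>v x = T *\<^sub>v (H *\<^sub>v (mat_adjoint T *\<^sub>v x))"
    using assms mult_mat_vec_carrier[OF mat_adjoint_carrier[OF assms(1)] assms(3)]
      mult_carrier_mat[OF assms(1,2)]
    by (simp add: assoc_mult_mat_vec[of "T * H" m n _ m] assoc_mult_mat_vec[of T m n H n])
  then show ?thesis
    using cscalar_prod_adjoint[OF assms(1) mult_mat_vec_carrier[OF assms(2)
        mult_mat_vec_carrier[OF mat_adjoint_carrier[OF assms(1)] assms(3)]] assms(3)]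
    by (simp add: qform_def)
qed

lemma hermitian_congruence:
  assumes "T \<in> carrier_mat m n" "H \<in> carrier_mat n n" "hermitian_mat H"
  shows "hermitian_mat (T * H * mat_adjoint T)"
proof -
  have "mat_adjoint (T * H * mat_adjoint T) = T * mat_adjoint (T * H)"
    using mat_adjoint_mult[OF mult_carrier_mat[OF assms(1,2)] mat_adjoint_carrier[OF assms(1)]] by simp
  also have "\<dots> = T * (H * mat_adjoint T)"
    using mat_adjoint_mult[OF assms(1,2)] assms(3) by (simp add: hermitian_mat_def)
  also have "\<dots> = T * H * mat_adjoint T"
    using assoc_mult_mat[OF assms(1,2) mat_adjoint_carrier[OF assms(1)]] by simp
  finally show ?thesis unfolding hermitian_mat_def .
qed

lemma hermitian_index:
  assumes "H \<in> carrier_mat n n" "hermitian_mat H" "i < n" "j < n"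
  shows "H $$ (j, i) = cnj (H $$ (i, j))"
  using assms index_mat_adjoint[of j H i] by (auto simp: hermitian_mat_def)

section \<open>The spectral theorem\<close>

text \<open>Supplies the change of basis for one deflation step: Gram-Schmidt is run on a basis
  starting with \<open>v\<close>, and the resulting orthogonal vectors are normalised to become the
  columns of \<open>U\<close>.\<close>

lemma unitary_completion:
  fixes v :: "complex vec"
  assumes v: "v \<in> carrier_vec n" and v0: "v \<noteq> 0\<^sub>v n"
  obtains U c where "U \<in> carrier_mat n n" "mat_adjoint U * U = 1\<^sub>m n" "col U 0 = c \<cdot>\<^sub>v v"
proof -
  interpret cof_vec_space n "TYPE(complex)" .
  define ws where "ws = gram_schmidt n (basis_completion v)"
  note bc = basis_completion[OF v v0]
  note gs = gram_schmidt_result[OF bc(2,4,5) ws_def]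
  have len: "length ws = n" using gs(4) bc(6) by simp
  have n: "n > 0" using v v0 by (cases n) auto
  have bne: "basis_completion v \<noteq> []" using bc(6) n by auto
  \<comment> \<open>Gram-Schmidt leaves the first vector of its input unchanged.\<close>
  have "hd ws = v"
    using bc(7) bne v unfolding ws_def by (cases "basis_completion v") auto
  then have w0: "ws ! 0 = v" using len n by (metis hd_conv_nth length_greater_0_conv)
  have wc: "ws ! i \<in> carrier_vec n" if "i < n" for i using gs(3) that len by auto
  have orth: "ws ! i \<bullet>c ws ! j = 0 \<longleftrightarrow> i \<noteq> j" if "i < n" "j < n" for i j
    using gs(2) that len unfolding corthogonal_def by auto
  \<comment> \<open>\<open>s i\<close> is the norm of the i-th orthogonal vector. It is nonzero
    because \<open>orth\<close> with \<open>i = j\<close> excludes isotropic vectors.\<close>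
  define s where "s i = sqrt (Re (ws ! i \<bullet>c ws ! i))" for i
  have s: "of_real (s i) * of_real (s i) = ws ! i \<bullet>c ws ! i" "s i \<noteq> 0" if "i < n" for i
  proof -
    have r: "ws ! i \<bullet>c ws ! i = of_real (\<Sum>j<n. (cmod (ws ! i $ j))\<^sup>2)"
      by (rule cscalar_prod_self[OF wc[OF that]])
    have nn: "(\<Sum>j<n. (cmod (ws ! i $ j))\<^sup>2) \<ge> 0" by (intro sum_nonneg) auto
    show "of_real (s i) * of_real (s i) = ws ! i \<bullet>c ws ! i"
      unfolding s_def r of_real_mult[symmetric] using nn by simp
    then show "s i \<noteq> 0" using orth[OF that that] by auto
  qed
  define U where "U = mat n n (\<lambda>(i, j). ws ! j $ i / of_real (s j))"
  have U: "U \<in> carrier_mat n n" by (simp add: U_def)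
  have ent: "(mat_adjoint U * U) $$ (i, j) = ws ! j \<bullet>c ws ! i / (of_real (s i) * of_real (s j))"
    if "i < n" "j < n" for i j
    using that wc[OF that(1)] wc[OF that(2)] U by (auto simp: U_def scalar_prod_def sum_divide_distrib mult.commute intro!: sum.cong)
  have "mat_adjoint U * U = 1\<^sub>m n"
    using U ent orth s by (intro eq_matI) auto
  moreover have "col U 0 = (1 / of_real (s 0)) \<cdot>\<^sub>v v"
    using n v w0 by (intro eq_vecI) (auto simp: U_def)
  ultimately show ?thesis using that U by blast
qed

text \<open>Deflation: in an orthonormal basis starting with an eigenvector, a Hermitian matrix
  splits into the eigenvalue and a Hermitian block of size one less, to which the induction
  hypothesis applies. That the entries of \<open>B\<close> are real is recovered later from
  hermiticity.\<close>

theorem hermitian_spectral: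
  assumes "H \<in> carrier_mat n n" "hermitian_mat H"
  shows "\<exists>U B. U \<in> carrier_mat n n \<and> B \<in> carrier_mat n n \<and> mat_adjoint U * U = 1\<^sub>m n \<and>
    diagonal_mat B \<and> H = U * B * mat_adjoint U"
  using assms
proof (induction n arbitrary: H)
  case 0
  then show ?case
    by (intro exI[of _ "1\<^sub>m 0"] exI[of _ H]) (auto simp: diagonal_mat_def)
next
  case (Suc n)
  let ?n = "Suc n"
  note H = Suc.prems
  obtain e where "eigenvalue H e"
    using spectrum_non_empty[OF H(1)] by (auto simp: spectrum_def)
  then obtain v where v: "v \<in> carrier_vec ?n" "v \<noteq> 0\<^sub>v ?n" "H *\<^sub>v v = e \<cdot>\<^sub>v v"
    using H by (auto simp: eigenvalue_def eigenvector_def)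
  obtain U c where U: "U \<in> carrier_mat ?n ?n" "mat_adjoint U * U = 1\<^sub>m ?n" "col U 0 = c \<cdot>\<^sub>v v"
    using unitary_completion[OF v(1,2)] .
  let ?V = "mat_adjoint U"
  have V: "?V \<in> carrier_mat ?n ?n" using U by simp
  have UV: "U * ?V = 1\<^sub>m ?n" using mat_mult_left_right_inverse[OF V U(1) U(2)] .
  define X where "X = ?V * H * U"
  have X: "X \<in> carrier_mat ?n ?n" unfolding X_def using mult_carrier_mat[OF mult_carrier_mat[OF V H(1)] U(1)] .
  have hX: "hermitian_mat X"
    using hermitian_congruence[OF V H] by (simp add: X_def)
  have u0: "col U 0 \<in> carrier_vec ?n" using U(1) by (metis carrier_matD(1) col_dim)
  have "col X 0 = ?V *\<^sub>v (H *\<^sub>v col U 0)"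
    unfolding X_def using col_mult2[OF mult_carrier_mat[OF V H(1)] U(1), of 0]
      assoc_mult_mat_vec[OF V H(1) u0] U(1) by simp
  also have "H *\<^sub>v col U 0 = e \<cdot>\<^sub>v col U 0"
    unfolding U(3) using v(1,3) H
    by (auto simp: mult_mat_vec[of _ ?n ?n] smult_smult_assoc mult.commute)
  also have "?V *\<^sub>v (e \<cdot>\<^sub>v col U 0) = e \<cdot>\<^sub>v col (?V * U) 0"
    using mult_mat_vec[OF V u0] col_mult2[OF V U(1), of 0] by simp
  finally have colX: "col X 0 = e \<cdot>\<^sub>v col (1\<^sub>m ?n) 0" using U(2) by simp
  have X0: "X $$ (i, 0) = (if i = 0 then e else 0)" if "i < ?n" for i
    using arg_cong[OF colX, of "\<lambda>w. w $ i"] X that by simp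
  \<comment> \<open>The eigenvector clears the first column; hermiticity carries the zeros over to
    the first row.\<close>
  have X0': "X $$ (0, i) = 0" if "i < ?n" "i \<noteq> 0" for i
    using hermitian_index[OF X hX, of i 0] X0[of i] that by simp
  define Y where "Y = mat n n (\<lambda>(i, j). X $$ (Suc i, Suc j))"
  have Y: "Y \<in> carrier_mat n n" by (simp add: Y_def)
  have "hermitian_mat Y" unfolding hermitian_mat_def
    using X by (intro eq_matI) (auto simp: Y_def intro!: hermitian_index[OF X hX, symmetric])
  from Suc.IH[OF Y this] obtain W B where W: "W \<in> carrier_mat n n" "mat_adjoint W * W = 1\<^sub>m n"
    and B: "B \<in> carrier_mat n n" "diagonal_mat B" and YW: "Y = W * B * mat_adjoint W" by blast
  let ?e = "mat 1 1 (\<lambda>_. e)"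
  let ?z = "0\<^sub>m 1 n" and ?z' = "0\<^sub>m n 1"
  \<comment> \<open>The diagonalisation of the small block is extended by the identity on the
    eigenvector.\<close>
  define W1 where "W1 = four_block_mat (1\<^sub>m 1) ?z ?z' W"
  define B1 where "B1 = four_block_mat ?e ?z ?z' B"
  have W1: "W1 \<in> carrier_mat ?n ?n" and B1: "B1 \<in> carrier_mat ?n ?n"
    using four_block_carrier_mat[of "1\<^sub>m 1" 1 1 W n n ?z ?z'] four_block_carrier_mat[of ?e 1 1 B n n ?z ?z'] W B
    by (simp_all add: W1_def B1_def)
  have aW1: "mat_adjoint W1 = four_block_mat (1\<^sub>m 1) ?z ?z' (mat_adjoint W)"
    unfolding W1_def using W by (subst mat_adjoint_four_block[of _ 1 1 _ n _ n]) auto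
  have uW1: "mat_adjoint W1 * W1 = 1\<^sub>m ?n"
    unfolding aW1 unfolding W1_def using W
    by (subst mult_four_block_mat[of _ 1 1 _ n _ n _ _ 1 _ n]) auto
  have "X = four_block_mat ?e ?z ?z' Y"
  proof (rule eq_matI)
    fix i j assume "i < dim_row (four_block_mat ?e ?z ?z' Y)" "j < dim_col (four_block_mat ?e ?z ?z' Y)"
    then have ij: "i < ?n" "j < ?n" using Y by auto
    show "X $$ (i, j) = four_block_mat ?e ?z ?z' Y $$ (i, j)"
      using ij X0[of i] X0'[of j] Y by (cases i; cases j) (simp_all add: Y_def)
  qed (use X Y in auto)
  also have "\<dots> = W1 * B1 * mat_adjoint W1"
    unfolding aW1 unfolding W1_def B1_def using W B
      mult_carrier_mat[OF mult_carrier_mat[OF W(1) B(1)] mat_adjoint_carrier[OF W(1)]]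
    by (simp add: mult_four_block_mat[of _ 1 1 _ n _ n _ _ 1 _ n] YW)
  finally have XW: "X = W1 * B1 * mat_adjoint W1" .
  have dB1: "diagonal_mat B1" using B by (auto simp: diagonal_mat_def B1_def)
  let ?U = "U * W1"
  have aU: "mat_adjoint ?U = mat_adjoint W1 * ?V"
    using U W1 by (simp add: mat_adjoint_mult[of _ ?n ?n _ ?n])
  have aW1c: "mat_adjoint W1 \<in> carrier_mat ?n ?n" using W1 by simp
  note assoc = assoc_mult_mat[of _ ?n ?n _ ?n _ ?n] and closed = mult_carrier_mat[of _ ?n ?n _ ?n]
  have "?V * ?U = W1" using assoc[OF V U(1) W1] U(2) W1 by simp
  then have 1: "mat_adjoint ?U * ?U = 1\<^sub>m ?n"
    unfolding aU using assoc[OF aW1c V closed[OF U(1) W1]] uW1 by simp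
  have "U * X = H * U"
    unfolding X_def using assoc[OF U(1) V closed[OF H(1) U(1)]] assoc[OF V H(1) U(1)] UV
      left_mult_one_mat[OF closed[OF H(1) U(1)]] by metis
  then have "H = U * X * ?V"
    using assoc[OF H(1) U(1) V] UV H(1) by simp
  also have "\<dots> = U * (W1 * B1) * mat_adjoint W1 * ?V"
    unfolding XW using assoc[OF U(1) closed[OF W1 B1] aW1c] by simp
  also have "\<dots> = ?U * B1 * mat_adjoint ?U"
    unfolding aU using assoc[OF U(1) W1 B1] assoc[OF closed[OF closed[OF U(1) W1] B1] aW1c V] by simp
  finally have "H = ?U * B1 * mat_adjoint ?U" .
  then show ?case using 1 dB1 B1 U W1 by (intro exI[of _ ?U] exI[of _ B1]) auto
qed

section \<open>Sylvester's law of inertia\<close>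

lemma order_prod_list_linear:
  fixes as :: "'a :: idom list"
  shows "order k (\<Prod>a\<leftarrow>as. [:- a, 1:]) = count_list as k"
proof (induction as)
  case Nil
  show ?case by (simp add: order_0I)
next
  case (Cons a as)
  have nz: "(\<Prod>a\<leftarrow>as. [:- a, 1:]) \<noteq> 0"
    by (auto simp: prod_list_zero_iff)
  have "order k [:- a, 1:] = (if a = k then 1 else 0)"
    using order_power_n_n[of k 1] by (auto intro!: order_0I)
  then show ?case
    using Cons nz by (simp add: order_mult del: mult_pCons_left)
qed

text \<open>The root list contains each eigenvalue as often as its algebraic multiplicity, so
  summing orders over the eigenvalues of one sign counts list entries of that sign.\<close>

lemma inertia_char_poly:
  assumes H: "H \<in> carrier_mat n n" and c: "char_poly H = (\<Prod>a\<leftarrow>as. [:- a, 1:])"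
  shows "inertia H = (length (filter (\<lambda>a. a > 0) as), length (filter (\<lambda>a. a < 0) as), count_list as 0)"
proof -
  have ev: "eigenvalue H k \<longleftrightarrow> k \<in> set as" for k
    unfolding eigenvalue_root_char_poly[OF H] c poly_prod_list
    by (induction as) auto
  have "(\<Sum>k | eigenvalue H k \<and> Q k. order k (char_poly H)) = length (filter Q as)" for Q
  proof -
    have "{k. eigenvalue H k \<and> Q k} = set (filter Q as)" by (auto simp: ev)
    moreover have "count_list as k = count_list (filter Q as) k" if "k \<in> set (filter Q as)" for k
    proof -
      from that have "Q k" by simp
      then show ?thesis by (induction as) auto
    qed
    ultimately show ?thesis
      unfolding c order_prod_list_linear using sum_count_set[of "filter Q as" "set (filter Q as)"] by simp
  qed
  then show ?thesis
    unfolding inertia_def c order_prod_list_linear by simp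
qed

text \<open>The characteristic polynomial of a block diagonal matrix is the product of those of the
  blocks, so the root lists are concatenated and the counts add up.\<close>

lemma inertia_four_block_diag:
  assumes A: "A \<in> carrier_mat n n" and B: "B \<in> carrier_mat m m"
  shows "inertia (four_block_mat A (0\<^sub>m n m) (0\<^sub>m m n) B) = inertia A + inertia B"
proof -
  obtain as bs where c: "char_poly A = (\<Prod>a\<leftarrow>as. [:- a, 1:])" "char_poly B = (\<Prod>a\<leftarrow>bs. [:- a, 1:])"
    using char_poly_factorized[OF A] char_poly_factorized[OF B] by auto
  have "char_poly (four_block_mat A (0\<^sub>m n m) (0\<^sub>m m n) B) = char_poly A * char_poly B"
    using c by (intro char_poly_0_block[OF refl _ _ A _ B]) auto
  also have "\<dots> = (\<Prod>a\<leftarrow>as @ bs. [:- a, 1:])" using c by simp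
  finally have "char_poly (four_block_mat A (0\<^sub>m n m) (0\<^sub>m m n) B) = \<dots>" .
  from inertia_char_poly[OF _ this] show ?thesis
    using inertia_char_poly[OF A c(1)] inertia_char_poly[OF B c(2)]
      four_block_carrier_mat[OF A B] by (auto simp: plus_prod_def)
qed

lemma inertia_smult_one:
  "inertia (of_real c \<cdot>\<^sub>m 1\<^sub>m r) =
    (if c > 0 then r else 0, if c < 0 then r else 0, if c = 0 then r else 0)"
proof -
  let ?H = "of_real c \<cdot>\<^sub>m 1\<^sub>m r :: complex mat"
  have H: "?H \<in> carrier_mat r r" by simp
  have d: "diag_mat ?H = replicate r (of_real c)"
    by (auto simp: diag_mat_def intro!: nth_equalityI)
  have "upper_triangular ?H" by (auto simp: upper_triangular_def)
  from char_poly_upper_triangular[OF H this]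
  have "char_poly ?H = (\<Prod>a\<leftarrow>replicate r (of_real c). [:- a, 1:])" by (simp only: d)
  from inertia_char_poly[OF H this] show ?thesis
    by (auto simp: less_complex_def count_list_eq_length_filter)
qed

text \<open>A homogeneous system with fewer equations than unknowns, padded with zero equations to a
  square one, has determinant zero and hence a nontrivial solution.\<close>

lemma short_system_solution:
  fixes L :: "'a :: field vec list"
  assumes L: "set L \<subseteq> carrier_vec n" and len: "length L < n"
  obtains v where "v \<in> carrier_vec n" "v \<noteq> 0\<^sub>v n" "\<And>l. l \<in> set L \<Longrightarrow> l \<bullet> v = 0"
proof -
  define L' where "L' = L @ replicate (n - length L) (0\<^sub>v n)"
  have len': "length L' = n" and L': "set L' \<subseteq> carrier_vec n"
    using len L by (auto simp: L'_def)
  define Q where "Q = mat_of_rows n L'"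
  have Q: "Q \<in> carrier_mat n n" using mat_of_rows_carrier(1)[of n L'] len' by (simp add: Q_def)
  have last: "L' ! (n - 1) = 0\<^sub>v n" using len by (auto simp: L'_def nth_append)
  have "row Q (n - 1) = 0\<^sub>v n"
    using len last len' by (simp add: Q_def mat_of_rows_row)
  \<comment> \<open>The last row of \<open>Q\<close> is a padded zero row, so the transpose kills
    the last unit vector and is singular.\<close>
  then have "transpose_mat Q *\<^sub>v unit_vec n (n - 1) = 0\<^sub>v n"
    using len Q by (intro eq_vecI) (auto simp: scalar_prod_right_unit[of _ n] row_def vec_eq_iff)
  moreover have "unit_vec n (n - 1) \<noteq> (0\<^sub>v n :: 'a vec)"
    using len by (metis diff_less gr_implies_not0 less_one nat_neq_iff unit_vec_nonzero)
  ultimately have "det (transpose_mat Q) = 0"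
    using det_0_iff_vec_prod_zero_field[of "transpose_mat Q" n] Q by (meson transpose_carrier_mat unit_vec_carrier)
  then have "det Q = 0" using det_transpose[OF Q] by simp
  then obtain v where v: "v \<in> carrier_vec n" "v \<noteq> 0\<^sub>v n" "Q *\<^sub>v v = 0\<^sub>v n"
    using det_0_iff_vec_prod_zero_field[OF Q] by blast
  have "l \<bullet> v = 0" if "l \<in> set L" for l
  proof -
    have "l \<in> set L'" using that by (simp add: L'_def)
    then obtain i where i: "i < n" "l = L' ! i"
      using len' by (auto simp: in_set_conv_nth)
    have "row Q i = l" using i L' len' by (auto simp: Q_def intro!: mat_of_rows_row)
    then have "(Q *\<^sub>v v) $ i = l \<bullet> v" using i(1) Q by simp
    then show ?thesis using v(3) i by simp
  qed
  with v show ?thesis using that by blast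
qed

text \<open>The dimension count behind Sylvester's law. If the left count were larger, there would
  be a nonzero vector whose \<open>R'\<close> coordinates vanish wherever \<open>d'\<close> is
  positive and whose \<open>R\<close> coordinates vanish wherever \<open>d\<close> is not. The form
  would then be nonpositive in one representation and positive in the other.\<close>

lemma pos_index_le:
  fixes d d' :: "nat \<Rightarrow> real" and R R' :: "complex mat"
  assumes R: "R \<in> carrier_mat n n" "det R \<noteq> 0" and R': "R' \<in> carrier_mat n n"
    and eq: "\<And>x. x \<in> carrier_vec n \<Longrightarrow>
      (\<Sum>i<n. d' i * (cmod ((R' *\<^sub>v x) $ i))\<^sup>2) = (\<Sum>i<n. d i * (cmod ((R *\<^sub>v x) $ i))\<^sup>2)"
  shows "card {i. i < n \<and> d i > 0} \<le> card {i. i < n \<and> d' i > 0}"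
proof (rule ccontr)
  assume less: "\<not> ?thesis"
  \<comment> \<open>There is one equation for each positive \<open>d' i\<close> and one for each
    nonpositive \<open>d i\<close>; under the assumption \<open>less\<close> these are fewer than
    \<open>n\<close>.\<close>
  define L where "L = map (row R') (filter (\<lambda>i. d' i > 0) [0..<n]) @
    map (row R) (filter (\<lambda>i. \<not> d i > 0) [0..<n])"
  have cf: "length (filter Q [0..<n]) = card {i. i < n \<and> Q i}" for Q
    by (simp add: length_filter_conv_card) (metis (no_types, lifting) add_0 nth_upt)
  have "length (filter (\<lambda>i. d i > 0) [0..<n]) + length (filter (\<lambda>i. \<not> d i > 0) [0..<n]) = n"
    using sum_length_filter_compl[of "\<lambda>i. d i > 0" "[0..<n]"] by simp
  then have "length L < n" using less unfolding L_def by (simp add: cf)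
  moreover have "set L \<subseteq> carrier_vec n" using R R' by (auto simp: L_def)
  ultimately obtain v where v: "v \<in> carrier_vec n" "v \<noteq> 0\<^sub>v n" "\<And>l. l \<in> set L \<Longrightarrow> l \<bullet> v = 0"
    using short_system_solution[of L n] by blast
  have v0: "(R' *\<^sub>v v) $ i = 0" if "i < n" "d' i > 0" for i
    using v(3)[of "row R' i"] that R' by (auto simp: L_def)
  have Rv0: "(R *\<^sub>v v) $ i = 0" if "i < n" "\<not> d i > 0" for i
    using v(3)[of "row R i"] that R by (auto simp: L_def)
  \<comment> \<open>Invertibility of \<open>R\<close> leaves some coordinate of
    \<open>R *\<^sub>v v\<close> nonzero. By \<open>Rv0\<close> its index has positive
    \<open>d i\<close>, which makes the form strictly positive.\<close>
  have "R *\<^sub>v v \<noteq> 0\<^sub>v n" using det_0_iff_vec_prod_zero_field[OF R(1)] R(2) v by blast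
  moreover have Rv: "R *\<^sub>v v \<in> carrier_vec n" using R v by auto
  ultimately obtain i where i: "i < n" "(R *\<^sub>v v) $ i \<noteq> 0"
    by (metis carrier_vecD eq_vecI index_zero_vec)
  have "0 < (\<Sum>i<n. d i * (cmod ((R *\<^sub>v v) $ i))\<^sup>2)"
    using i Rv0 by (intro sum_pos2[of _ i]) (auto, force, metis less_eq_real_def mult_eq_0_iff
        norm_zero zero_eq_power2 zero_le_mult_iff zero_le_power2)
  moreover have "(\<Sum>i<n. d' i * (cmod ((R' *\<^sub>v v) $ i))\<^sup>2) \<le> 0"
    using v0 by (intro sum_nonpos) (metis lessThan_iff linorder_not_less mult_eq_0_iff
        mult_nonpos_nonneg norm_zero order_refl zero_eq_power2 zero_le_power2)
  ultimately show False using eq[OF v(1)] by simp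
qed

text \<open>The coordinate change obtained here is the adjoint of the unitary matrix of the spectral
  theorem. Since that matrix is unitary, the diagonal matrix is both congruent and similar to
  \<open>H\<close>: congruence gives the form, similarity gives the inertia.\<close>

lemma hermitian_diagonal_congruence:
  assumes "H \<in> carrier_mat n n" "hermitian_mat H"
  obtains U d where "U \<in> carrier_mat n n" "det U \<noteq> 0"
    "\<And>x. x \<in> carrier_vec n \<Longrightarrow> hform H x = (\<Sum>i<n. d i * (cmod ((U *\<^sub>v x) $ i))\<^sup>2)"
    "inertia H = (card {i. i < n \<and> d i > 0}, card {i. i < n \<and> d i < 0}, card {i. i < n \<and> d i = 0})"
proof -
  from hermitian_spectral[OF assms] obtain U B where U: "U \<in> carrier_mat n n"
    "mat_adjoint U * U = 1\<^sub>m n" and B: "B \<in> carrier_mat n n" "diagonal_mat B"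
    and HU: "H = U * B * mat_adjoint U" by blast
  let ?V = "mat_adjoint U"
  have V: "?V \<in> carrier_mat n n" using U by simp
  have UV: "U * ?V = 1\<^sub>m n" using mat_mult_left_right_inverse[OF V U(1) U(2)] .
  have BV: "B * ?V \<in> carrier_mat n n" using B(1) V by simp
  have "?V * H = B * ?V"
    unfolding HU using assoc_mult_mat[OF U(1) B(1) V] assoc_mult_mat[OF V U(1) BV] U(2)
      left_mult_one_mat[OF BV] by simp
  \<comment> \<open>This exhibits \<open>B\<close> as a congruence transform of \<open>H\<close>,
    hence as Hermitian, so its diagonal is real.\<close>
  then have "B = ?V * H * U"
    using assoc_mult_mat[OF B(1) V U(1)] U(2) B(1) by simp
  then have hB: "hermitian_mat B" using hermitian_congruence[OF V assms] by simp
  define d where "d i = Re (B $$ (i, i))" for i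
  have Bd: "B $$ (i, i) = of_real (d i)" if "i < n" for i
    using hermitian_index[OF B(1) hB that that] unfolding d_def by (metis Reals_cnj_iff of_real_Re)
  have Bv: "(B *\<^sub>v y) $ i = of_real (d i) * y $ i" if "i < n" "y \<in> carrier_vec n" for i y
  proof -
    have "(B *\<^sub>v y) $ i = (\<Sum>j<n. B $$ (i, j) * y $ j)"
      using that B by (auto simp: scalar_prod_def lessThan_atLeast0)
    also have "\<dots> = (\<Sum>j<n. if j = i then of_real (d i) * y $ i else 0)"
      using that B Bd by (intro sum.cong) (auto simp: diagonal_mat_def)
    finally show ?thesis using that by simp
  qed
  have qB: "qform B y = (\<Sum>i<n. (B *\<^sub>v y) $ i * cnj (y $ i))" if "y \<in> carrier_vec n" for y
    unfolding qform_def using that by (auto simp: scalar_prod_def lessThan_atLeast0)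
  have "hform H x = (\<Sum>i<n. d i * (cmod ((?V *\<^sub>v x) $ i))\<^sup>2)" if x: "x \<in> carrier_vec n" for x
  proof -
    let ?y = "?V *\<^sub>v x"
    have y: "?y \<in> carrier_vec n" using V x by simp
    have "qform H x = qform B ?y"
      unfolding HU by (rule qform_congruence[OF U(1) B(1) x])
    also have "\<dots> = (\<Sum>i<n. (B *\<^sub>v ?y) $ i * cnj (?y $ i))"
      using qB[OF y] .
    also have "\<dots> = (\<Sum>i<n. of_real (d i * (cmod (?y $ i))\<^sup>2))"
      using Bv[OF _ y] by (intro sum.cong) (auto simp: mult.assoc complex_norm_square[symmetric] simp del: of_real_power)
    finally show ?thesis unfolding hform_def by (simp add: Re_sum)
  qed
  moreover have "inertia H = (card {i. i < n \<and> d i > 0}, card {i. i < n \<and> d i < 0}, card {i. i < n \<and> d i = 0})"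
  proof -
    let ?as = "map (\<lambda>i. of_real (d i) :: complex) [0..<n]"
    have "similar_mat H B" unfolding similar_mat_def
      using similar_mat_witI[OF UV U(2) HU assms(1) B(1) U(1) V] by blast
    then have "char_poly H = char_poly B" by (rule char_poly_similar)
    also have "\<dots> = (\<Prod>a\<leftarrow>diag_mat B. [:- a, 1:])"
      using B by (intro char_poly_upper_triangular[of _ n]) (auto simp: diagonal_mat_def upper_triangular_def)
    also have "diag_mat B = ?as" using B Bd by (auto simp: diag_mat_def)
    finally have "char_poly H = (\<Prod>a\<leftarrow>?as. [:- a, 1:])" .
    note * = inertia_char_poly[OF assms(1) this]
    have cf: "length (filter Q [0..<n]) = card {i. i < n \<and> Q i}" for Q
      by (simp add: length_filter_conv_card) (metis (no_types, lifting) add_0 nth_upt)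
    show ?thesis unfolding * count_list_eq_length_filter
      by (simp add: filter_map o_def cf less_complex_def eq_commute[of 0])
  qed
  moreover have "det ?V \<noteq> 0"
    using det_mult[OF V U(1)] U(2) by auto
  ultimately show ?thesis using that V by blast
qed

lemma det_mat_adjoint:
  fixes A :: "complex mat"
  assumes "A \<in> carrier_mat n n"
  shows "det (mat_adjoint A) = cnj (det A)"
proof -
  interpret cnj: comm_ring_hom cnj by unfold_locales auto
  have "mat_adjoint A = map_mat cnj (transpose_mat A)" by (rule eq_matI) auto
  then show ?thesis using det_transpose[OF assms] by (simp add: cnj.hom_det)
qed

text \<open>The form of the transformed matrix at \<open>x\<close> is the form of \<open>H\<close>
  at \<open>mat_adjoint T *\<^sub>v x\<close>. Hence diagonalising both matrices gives two diagonal
  representations of one form, with invertible coordinate changes, and their indices can be compared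
  in both directions.\<close>

theorem sylvester_inertia:
  assumes H: "H \<in> carrier_mat n n" "hermitian_mat H" and T: "T \<in> carrier_mat n n" "det T \<noteq> 0"
  shows "inertia (T * H * mat_adjoint T) = inertia H"
proof -
  let ?H' = "T * H * mat_adjoint T"
  have H': "?H' \<in> carrier_mat n n" using mult_carrier_mat[OF mult_carrier_mat[OF T(1) H(1)]] T by simp
  have aT: "mat_adjoint T \<in> carrier_mat n n" using T by simp
  obtain U d where U: "U \<in> carrier_mat n n" "det U \<noteq> 0"
    and Ud: "\<And>x. x \<in> carrier_vec n \<Longrightarrow> hform H x = (\<Sum>i<n. d i * (cmod ((U *\<^sub>v x) $ i))\<^sup>2)"
    and iH: "inertia H = (card {i. i < n \<and> d i > 0}, card {i. i < n \<and> d i < 0}, card {i. i < n \<and> d i = 0})"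
    using hermitian_diagonal_congruence[OF H] by blast
  obtain U' d' where U': "U' \<in> carrier_mat n n" "det U' \<noteq> 0"
    and Ud': "\<And>x. x \<in> carrier_vec n \<Longrightarrow> hform ?H' x = (\<Sum>i<n. d' i * (cmod ((U' *\<^sub>v x) $ i))\<^sup>2)"
    and iH': "inertia ?H' = (card {i. i < n \<and> d' i > 0}, card {i. i < n \<and> d' i < 0}, card {i. i < n \<and> d' i = 0})"
    using hermitian_diagonal_congruence[OF H' hermitian_congruence[OF T(1) H]] by blast
  let ?R = "U * mat_adjoint T"
  have R: "?R \<in> carrier_mat n n" "det ?R \<noteq> 0"
    using U aT T(2) det_mult[OF U(1) aT] det_mat_adjoint[OF T(1)] by (auto intro: mult_carrier_mat)
  have eq: "(\<Sum>i<n. d' i * (cmod ((U' *\<^sub>v x) $ i))\<^sup>2) = (\<Sum>i<n. d i * (cmod ((?R *\<^sub>v x) $ i))\<^sup>2)"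
    if x: "x \<in> carrier_vec n" for x
    using Ud'[OF x] Ud[OF mult_mat_vec_carrier[OF aT x]] qform_congruence[OF T(1) H(1) x]
      assoc_mult_mat_vec[OF U(1) aT x] by (simp add: hform_def)
  have pos: "card {i. i < n \<and> d i > 0} = card {i. i < n \<and> d' i > 0}"
    using pos_index_le[OF R U'(1) eq] pos_index_le[OF U' R(1) eq[symmetric]] by simp
  \<comment> \<open>Negating the coefficients turns the comparison of positive indices into one of
    negative indices.\<close>
  have eq': "(\<Sum>i<n. - d' i * (cmod ((U' *\<^sub>v x) $ i))\<^sup>2) = (\<Sum>i<n. - d i * (cmod ((?R *\<^sub>v x) $ i))\<^sup>2)"
    if x: "x \<in> carrier_vec n" for x
    using eq[OF x] by (simp add: sum_negf)
  have neg: "card {i. i < n \<and> d i < 0} = card {i. i < n \<and> d' i < 0}"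
    using pos_index_le[OF R U'(1) eq'] pos_index_le[OF U' R(1) eq'[symmetric]] by simp
  \<comment> \<open>The three counts sum to \<open>n\<close>, so equality of the first two forces
    equality of the third.\<close>
  have tot: "card {i. i < n \<and> f i > 0} + card {i. i < n \<and> f i < 0} + card {i. i < n \<and> f i = 0} = n"
    for f :: "nat \<Rightarrow> real"
  proof -
    let ?P = "{i. i < n \<and> f i > 0}" and ?N = "{i. i < n \<and> f i < 0}" and ?Z = "{i. i < n \<and> f i = 0}"
    have "card (?P \<union> ?N \<union> ?Z) = card (?P \<union> ?N) + card ?Z"
      by (rule card_Un_disjoint) auto
    also have "card (?P \<union> ?N) = card ?P + card ?N"
      by (rule card_Un_disjoint) auto
    also have "?P \<union> ?N \<union> ?Z = {..<n}" by auto
    finally show ?thesis by simp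
  qed
  show ?thesis using pos neg tot[of d] tot[of d'] by (simp add: iH iH')
qed

section \<open>A gap between the eigenvalues of a hyperbolic polynomial\<close>

text \<open>The two mixed terms are conjugate to each other, so with real coefficients they add up
  to twice a real part. Along a segment the form is therefore a real quadratic polynomial.\<close>

lemma hform_lincomb:
  fixes a b :: real
  assumes H: "H \<in> carrier_mat n n" "hermitian_mat H" and x: "x \<in> carrier_vec n" and y: "y \<in> carrier_vec n"
  shows "hform H (of_real a \<cdot>\<^sub>v x + of_real b \<cdot>\<^sub>v y) =
    a\<^sup>2 * hform H x + b\<^sup>2 * hform H y + 2 * a * b * Re ((H *\<^sub>v x) \<bullet>c y)"
proof -
  let ?a = "of_real a :: complex" and ?b = "of_real b :: complex"
  let ?u = "H *\<^sub>v x" and ?w = "H *\<^sub>v y"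
  have u: "?u \<in> carrier_vec n" and w: "?w \<in> carrier_vec n" using H x y by auto
  have cx: "conjugate x \<in> carrier_vec n" and cy: "conjugate y \<in> carrier_vec n" using x y by auto
  have "H *\<^sub>v (?a \<cdot>\<^sub>v x + ?b \<cdot>\<^sub>v y) = ?a \<cdot>\<^sub>v ?u + ?b \<cdot>\<^sub>v ?w"
    using mult_add_distrib_mat_vec[OF H(1), of "?a \<cdot>\<^sub>v x" "?b \<cdot>\<^sub>v y"] mult_mat_vec[OF H(1)] x y by simp
  moreover have "conjugate (?a \<cdot>\<^sub>v x + ?b \<cdot>\<^sub>v y) = ?a \<cdot>\<^sub>v conjugate x + ?b \<cdot>\<^sub>v conjugate y"
    using x y by (subst conjugate_add_vec[of _ n]) (auto simp: conjugate_smult_vec)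
  moreover have "?w \<bullet>c x = cnj (?u \<bullet>c y)"
    using cscalar_prod_adjoint[OF H(1) y x] cscalar_prod_swap[OF u y] H(2)
    by (simp add: hermitian_mat_def)
  ultimately have "qform H (?a \<cdot>\<^sub>v x + ?b \<cdot>\<^sub>v y) =
      ?a * (?a * (?u \<bullet>c x) + ?b * (?u \<bullet>c y)) + ?b * (?a * cnj (?u \<bullet>c y) + ?b * (?w \<bullet>c y))"
    unfolding qform_def using u w cx cy
    by (simp add: add_scalar_prod_distrib[of _ n] scalar_prod_add_distrib[of _ n]
        smult_scalar_prod_distrib[of _ n] scalar_prod_smult_distrib[of _ n] algebra_simps)
  then show ?thesis
    unfolding hform_def qform_def by (simp add: power2_eq_square algebra_simps)
qed

lemma hform_smult:
  assumes H: "H \<in> carrier_mat n n" and x: "x \<in> carrier_vec n"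
  shows "hform H (c \<cdot>\<^sub>v x) = (cmod c)\<^sup>2 * hform H x"
proof -
  have "qform H (c \<cdot>\<^sub>v x) = c * (cnj c * qform H x)"
    unfolding qform_def using H x mult_mat_vec_carrier[OF H x]
    by (simp add: mult_mat_vec[OF H] conjugate_smult_vec
      smult_scalar_prod_distrib[of _ n] scalar_prod_smult_distrib[of _ n])
  also have "\<dots> = of_real ((cmod c)\<^sup>2) * qform H x" by (simp add: complex_norm_square del: of_real_power)
  finally show ?thesis by (simp add: hform_def del: of_real_power)
qed

text \<open>The segment from \<open>x\<close> to \<open>y\<close> or \<open>-y\<close> stays in the set where \<open>B\<close> is nonnegative,
  provided the sign makes the cross term nonnegative.\<close>

lemma hform_no_sign_change:
  assumes B: "B \<in> carrier_mat n n" "hermitian_mat B" and F: "F \<in> carrier_mat n n" "hermitian_mat F"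
    and nz: "\<And>v. v \<in> carrier_vec n \<Longrightarrow> v \<noteq> 0\<^sub>v n \<Longrightarrow> hform B v \<ge> 0 \<Longrightarrow> hform F v \<noteq> 0"
    and x: "x \<in> carrier_vec n" "hform B x \<ge> 0" "hform F x > 0"
    and y: "y \<in> carrier_vec n" "hform B y \<ge> 0"
  shows "hform F y \<ge> 0"
proof (rule ccontr)
  assume neg: "\<not> hform F y \<ge> 0"
  define \<beta> where "\<beta> = Re ((B *\<^sub>v x) \<bullet>c y)"
  \<comment> \<open>Replacing \<open>y\<close> by \<open>-y\<close> changes neither of its forms but
    flips the cross term, so the sign can be chosen to make that term nonnegative.\<close>
  define c where "c = (if \<beta> \<ge> 0 then 1 else - 1 :: real)"
  have c: "c\<^sup>2 = 1" "c * \<beta> \<ge> 0" "c \<noteq> 0" by (auto simp: c_def)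
  define v where "v t = of_real (1 - t) \<cdot>\<^sub>v x + of_real (t * c) \<cdot>\<^sub>v y" for t :: real
  have vc: "v t \<in> carrier_vec n" for t using x y by (simp add: v_def)
  have "hform F (v 0) > 0" "hform F (v 1) < 0"
    using neg x(3) c by (simp_all only: v_def hform_lincomb[OF F x(1) y(1)]) (simp_all add: power_mult_distrib)
  moreover have "continuous_on {0..1} (\<lambda>t. hform F (v t))"
    unfolding v_def hform_lincomb[OF F x(1) y(1)] by (intro continuous_intros)
  ultimately obtain t where t: "0 \<le> t" "t \<le> 1" "hform F (v t) = 0"
    using IVT2'[of "\<lambda>t. hform F (v t)" 1 0 0] by fastforce
  have "hform B (v t) = (1 - t)\<^sup>2 * hform B x + t\<^sup>2 * hform B y + 2 * ((1 - t) * t) * (c * \<beta>)"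
    unfolding v_def hform_lincomb[OF B x(1) y(1)] using c(1)
    by (simp add: power_mult_distrib \<beta>_def)
  also have "\<dots> \<ge> 0"
    using t x(2) y(2) mult_nonneg_nonneg[of "2 * ((1 - t) * t)", OF _ c(2)]
    by (intro add_nonneg_nonneg) auto
  \<comment> \<open>At the zero of the form of \<open>F\<close> the form of \<open>B\<close> is
    still nonnegative, which \<open>nz\<close> permits only for the zero vector.\<close>
  finally have "v t = 0\<^sub>v n" using nz[OF vc] t(3) by blast
  \<comment> \<open>So \<open>x\<close> and \<open>y\<close> would be dependent with equal forms
    after scaling. One side is nonnegative and the other nonpositive, so both vanish, forcing
    \<open>t = 1\<close> and \<open>t = 0\<close> at once.\<close>
  have "of_real (1 - t) \<cdot>\<^sub>v x = of_real (- (t * c)) \<cdot>\<^sub>v y"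
  proof (rule eq_vecI)
    fix i assume "i < dim_vec (of_real (- (t * c)) \<cdot>\<^sub>v y)"
    then have i: "i < n" using y by simp
    have "v t $ i = 0" using \<open>v t = 0\<^sub>v n\<close> i by simp
    then show "(of_real (1 - t) \<cdot>\<^sub>v x) $ i = (of_real (- (t * c)) \<cdot>\<^sub>v y) $ i"
      using i x y by (simp add: v_def add_eq_0_iff2)
  qed (use x y in simp)
  then have "hform F (of_real (1 - t) \<cdot>\<^sub>v x) = hform F (of_real (- (t * c)) \<cdot>\<^sub>v y)" by simp
  then have e: "(1 - t)\<^sup>2 * hform F x = t\<^sup>2 * hform F y"
    unfolding hform_smult[OF F(1) x(1)] hform_smult[OF F(1) y(1)] norm_of_real
    using c(1) by (simp add: power_mult_distrib)
  have "(1 - t)\<^sup>2 * hform F x \<ge> 0" "t\<^sup>2 * hform F y \<le> 0"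
    using x(3) neg by (auto intro: mult_nonneg_nonpos)
  then have "(1 - t)\<^sup>2 * hform F x = 0" "t\<^sup>2 * hform F y = 0" using e by auto
  then show False using x(3) neg by auto
qed

section \<open>Forms of the quadratic matrix polynomial\<close>

lemma hermitian_quad_matpoly:
  fixes \<mu> :: real
  assumes "M \<in> carrier_mat n n" "D \<in> carrier_mat n n" "K \<in> carrier_mat n n"
    and "hermitian_mat M" "hermitian_mat D" "hermitian_mat K"
  shows "quad_matpoly M D K (of_real \<mu>) \<in> carrier_mat n n"
    "hermitian_mat (quad_matpoly M D K (of_real \<mu>))"
  using assms by (auto simp: quad_matpoly_def hermitian_mat_def mat_adjoint_add[of _ n n])

lemma hform_add:
  assumes "A \<in> carrier_mat n n" "B \<in> carrier_mat n n" "x \<in> carrier_vec n"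
  shows "hform (A + B) x = hform A x + hform B x"
  using assms mult_mat_vec_carrier[OF assms(1,3)] mult_mat_vec_carrier[OF assms(2,3)]
  by (simp add: hform_def qform_def add_mult_distrib_mat_vec[of _ n n] add_scalar_prod_distrib[of _ n])

lemma hform_smult_mat:
  fixes a :: real
  assumes "A \<in> carrier_mat n n" "x \<in> carrier_vec n"
  shows "hform (of_real a \<cdot>\<^sub>m A) x = a * hform A x"
proof -
  have "(of_real a \<cdot>\<^sub>m A) *\<^sub>v x = of_real a \<cdot>\<^sub>v (A *\<^sub>v x)"
    using assms by (intro eq_vecI) (auto simp: row_def scalar_prod_def sum_distrib_left mult.assoc)
  then show ?thesis
    using assms mult_mat_vec_carrier[OF assms] by (simp add: hform_def qform_def smult_scalar_prod_distrib[of _ n])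
qed

lemma hform_uminus:
  assumes "A \<in> carrier_mat n n" "x \<in> carrier_vec n"
  shows "hform (- A) x = - hform A x"
proof -
  have "- A = of_real (- 1) \<cdot>\<^sub>m A" by (rule eq_matI) auto
  then show ?thesis using hform_smult_mat[OF assms, of "- 1"] by simp
qed

lemma hform_quad_matpoly:
  fixes \<mu> :: real
  assumes "M \<in> carrier_mat n n" "D \<in> carrier_mat n n" "K \<in> carrier_mat n n" "x \<in> carrier_vec n"
  shows "hform (quad_matpoly M D K (of_real \<mu>)) x = \<mu>\<^sup>2 * hform M x + \<mu> * hform D x + hform K x"
  using assms hform_smult_mat[OF assms(1,4), of "\<mu>\<^sup>2"] hform_smult_mat[OF assms(2,4), of \<mu>]
  by (simp add: quad_matpoly_def hform_add[of _ n])

text \<open>Vectors of length \<open>n\<close> are modelled by functions vanishing from index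
  \<open>n\<close> on, which puts the sphere into the product topology on
  \<open>nat \<Rightarrow> complex\<close>. There it is a closed subset of a product of compact
  squares, so Tychonoff's theorem applies.\<close>

lemma compact_vec_sphere:
  "compact {f :: nat \<Rightarrow> complex. (\<forall>i\<ge>n. f i = 0) \<and> (\<Sum>i<n. (cmod (f i))\<^sup>2) = 1}" (is "compact ?S")
proof -
  let ?K = "(\<lambda>(a, b). of_real a + \<i> * of_real b) ` ({-1..1} \<times> {-1..1}) :: complex set"
  have K: "compact ?K"
    unfolding case_prod_unfold by (intro compact_continuous_image compact_Times compact_Icc continuous_intros)
  let ?T = "PiE UNIV (\<lambda>_. ?K) :: (nat \<Rightarrow> complex) set"
  have "compactin (product_topology (\<lambda>_. euclidean) UNIV) ?T"
    unfolding compactin_PiE using K by simp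
  then have T: "compact ?T" by (simp add: euclidean_product_topology)
  have coord: "continuous_on UNIV (\<lambda>f :: nat \<Rightarrow> complex. f i)" for i by simp
  have eq: "?S = {f. (\<Sum>i<n. (cmod (f i))\<^sup>2) = 1} \<inter> (\<Inter>i\<in>{n..}. {f. f i = 0})" by auto
  have "closed {f :: nat \<Rightarrow> complex. (\<Sum>i<n. (cmod (f i))\<^sup>2) = 1}"
    and "closed {f :: nat \<Rightarrow> complex. f i = 0}" for i
    by (intro closed_Collect_eq continuous_intros coord)+
  then have "closed ?S" unfolding eq by (intro closed_Int closed_INT ballI)
  moreover have "?S \<subseteq> ?T"
  proof (intro subsetI PiE_I)
    fix f i assume f: "f \<in> ?S"
    have "cmod (f i) \<le> 1"
    proof (cases "i < n")
      case True
      then have "(cmod (f i))\<^sup>2 \<le> (\<Sum>i<n. (cmod (f i))\<^sup>2)" by (intro member_le_sum) auto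
      then show ?thesis using f by (simp add: power_le_one_iff abs_square_le_1)
    qed (use f in auto)
    then have "\<bar>Re (f i)\<bar> \<le> 1" "\<bar>Im (f i)\<bar> \<le> 1"
      using abs_Re_le_cmod[of "f i"] abs_Im_le_cmod[of "f i"] by linarith+
    then show "f i \<in> ?K"
      by (intro image_eqI[of _ _ "(Re (f i), Im (f i))"]) (auto simp: complex_eq_iff)
  qed auto
  ultimately show ?thesis using T compact_Int_closed[of ?T ?S] by (simp add: Int_absorb1)
qed

lemma continuous_on_hform_vec:
  assumes "H \<in> carrier_mat n n"
  shows "continuous_on S (\<lambda>f. hform H (vec n f))"
proof -
  have eq: "hform H (vec n f) = Re (\<Sum>i<n. (\<Sum>j<n. H $$ (i, j) * f j) * cnj (f i))" for f
    using assms by (simp add: hform_def qform_def scalar_prod_def lessThan_atLeast0)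
  have coord: "continuous_on S (\<lambda>f :: nat \<Rightarrow> complex. f i)" for i
    by (rule continuous_on_subset[OF continuous_on_product_coordinates]) simp
  show ?thesis unfolding eq by (intro continuous_intros coord)
qed

text \<open>Passes from a discriminant condition on each vector separately to a single \<mu> that
  serves all vectors. The sign of \<mu> is left open here.\<close>

lemma hyperbolic_negative_point:
  assumes n: "n > 0"
    and M: "M \<in> carrier_mat n n" "hermitian_mat M" and D: "D \<in> carrier_mat n n" "hermitian_mat D"
    and K: "K \<in> carrier_mat n n" "hermitian_mat K"
    and m: "\<And>x. x \<in> carrier_vec n \<Longrightarrow> x \<noteq> 0\<^sub>v n \<Longrightarrow> hform M x > 0"
    and disc: "\<And>x. x \<in> carrier_vec n \<Longrightarrow> x \<noteq> 0\<^sub>v n \<Longrightarrow>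
      (hform D x)\<^sup>2 - 4 * hform M x * hform K x > 0"
  shows "\<exists>\<mu>::real. \<forall>x\<in>carrier_vec n. x \<noteq> 0\<^sub>v n \<longrightarrow> hform (quad_matpoly M D K (of_real \<mu>)) x < 0"
proof -
  define s where "s x = sqrt ((hform D x)\<^sup>2 - 4 * hform M x * hform K x)" for x
  define lo where "lo x = (- hform D x - s x) / (2 * hform M x)" for x
  define hi where "hi x = (- hform D x + s x) / (2 * hform M x)" for x
  let ?P = "\<lambda>\<mu>::real. quad_matpoly M D K (of_real \<mu>)"
  note P = hermitian_quad_matpoly[OF M(1) D(1) K(1) M(2) D(2) K(2)]
  note hP = hform_quad_matpoly[OF M(1) D(1) K(1)]
  have s: "s x > 0" "(s x)\<^sup>2 = (hform D x)\<^sup>2 - 4 * hform M x * hform K x"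
    if "x \<in> carrier_vec n" "x \<noteq> 0\<^sub>v n" for x
    using disc[OF that] by (auto simp: s_def)
  have fact: "hform (?P \<mu>) x = hform M x * ((\<mu> - lo x) * (\<mu> - hi x))"
    if x: "x \<in> carrier_vec n" "x \<noteq> 0\<^sub>v n" for x \<mu>
  proof -
    \<comment> \<open>Multiplying by \<open>4 * hform M x\<close> clears the denominators of both
      roots.\<close>
    have "4 * hform M x * (hform M x * ((\<mu> - lo x) * (\<mu> - hi x))) =
        (2 * hform M x * (\<mu> - lo x)) * (2 * hform M x * (\<mu> - hi x))" by simp
    also have "2 * hform M x * (\<mu> - lo x) = 2 * hform M x * \<mu> + hform D x + s x"
      using m[OF x] by (simp add: lo_def field_simps)
    also have "2 * hform M x * (\<mu> - hi x) = 2 * hform M x * \<mu> + hform D x - s x"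
      using m[OF x] by (simp add: hi_def field_simps)
    also have "(2 * hform M x * \<mu> + hform D x + s x) * (2 * hform M x * \<mu> + hform D x - s x) =
        (2 * hform M x * \<mu> + hform D x)\<^sup>2 - (s x)\<^sup>2"
      by (simp add: power2_eq_square algebra_simps)
    also have "\<dots> = 4 * hform M x * (\<mu>\<^sup>2 * hform M x + \<mu> * hform D x + hform K x)"
      unfolding s(2)[OF x] by (simp add: power2_eq_square algebra_simps)
    finally have "hform M x * ((\<mu> - lo x) * (\<mu> - hi x)) = \<mu>\<^sup>2 * hform M x + \<mu> * hform D x + hform K x"
      using m[OF x] by simp
    then show ?thesis using hP[OF x(1)] by simp
  qed
  have sep: "lo y < hi x"
    if x: "x \<in> carrier_vec n" "x \<noteq> 0\<^sub>v n" and y: "y \<in> carrier_vec n" "y \<noteq> 0\<^sub>v n" for x y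
  proof (rule ccontr)
    assume "\<not> lo y < hi x"
    define \<mu> where "\<mu> = hi x"
    have le: "\<mu> \<le> lo y" using \<open>\<not> lo y < hi x\<close> by (simp add: \<mu>_def)
    \<comment> \<open>\<open>F\<close> is the derivative of the polynomial at \<mu>.\<close>
    define F where "F = of_real (2 * \<mu>) \<cdot>\<^sub>m M + D"
    have F: "F \<in> carrier_mat n n" "hermitian_mat F"
      using M D by (auto simp: F_def hermitian_mat_def mat_adjoint_add[of _ n n])
    have hF: "hform F v = 2 * \<mu> * hform M v + hform D v" if "v \<in> carrier_vec n" for v
      using hform_smult_mat[OF M(1) that, of "2 * \<mu>"] M D that
      by (simp add: F_def hform_add[of _ n])
    have "hform F v \<noteq> 0" if v: "v \<in> carrier_vec n" "v \<noteq> 0\<^sub>v n" "hform (?P \<mu>) v \<ge> 0" for v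
    proof -
      \<comment> \<open>For a real quadratic, the squared derivative equals the discriminant plus
        four times the leading coefficient times the value. Where the value is nonnegative the
        derivative cannot vanish.\<close>
      have "(hform F v)\<^sup>2 = ((hform D v)\<^sup>2 - 4 * hform M v * hform K v) + 4 * hform M v * hform (?P \<mu>) v"
        unfolding hF[OF v(1)] hP[OF v(1)] by (simp add: power2_eq_square algebra_simps)
      also have "\<dots> > 0" using disc[OF v(1,2)] m[OF v(1,2)] v(3) by (intro add_pos_nonneg) auto
      finally show ?thesis by auto
    qed
    moreover have "hform (?P \<mu>) x \<ge> 0" unfolding fact[OF x] \<mu>_def by simp
    \<comment> \<open>At its larger root the quadratic of \<open>x\<close> has derivative
      \<open>s x\<close>.\<close>
    moreover have "hform F x > 0"
      unfolding hF[OF x(1)] \<mu>_def hi_def using m[OF x] s(1)[OF x] by (simp add: field_simps)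
    moreover have lh: "lo y < hi y" unfolding lo_def hi_def
      using m[OF y] s(1)[OF y] by (simp add: divide_strict_right_mono)
    then have "hform (?P \<mu>) y \<ge> 0"
      \<comment> \<open>As \<mu> lies at or below both roots of \<open>y\<close>, both linear
        factors are nonpositive.\<close>
      unfolding fact[OF y] using le m[OF y] by (intro mult_nonneg_nonneg mult_nonpos_nonpos) auto
    ultimately have "hform F y \<ge> 0"
      using hform_no_sign_change[OF P F] x(1) y(1) by blast
    moreover have "hform F y \<le> - s y"
    proof -
      have "2 * hform M y * \<mu> \<le> 2 * hform M y * lo y" using le m[OF y] by simp
      also have "\<dots> = - hform D y - s y" using m[OF y] by (simp add: lo_def)
      finally show ?thesis unfolding hF[OF y(1)] by (simp add: algebra_simps)
    qed
    ultimately show False using s(1)[OF y] by linarith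
  qed
  let ?S = "{f :: nat \<Rightarrow> complex. (\<forall>i\<ge>n. f i = 0) \<and> (\<Sum>i<n. (cmod (f i))\<^sup>2) = 1}"
  have vf: "vec n f \<in> carrier_vec n" "vec n f \<noteq> 0\<^sub>v n" if "f \<in> ?S" for f
  proof -
    show "vec n f \<noteq> 0\<^sub>v n"
    proof
      assume "vec n f = 0\<^sub>v n"
      then have "f i = 0" if "i < n" for i using that by (metis index_vec index_zero_vec(1))
      then show False using \<open>f \<in> ?S\<close> by simp
    qed
  qed simp
  \<comment> \<open>Attaining the extrema needs a nonempty sphere; this is where
    \<open>n > 0\<close> enters.\<close>
  have ne: "?S \<noteq> {}"
  proof -
    have "(\<Sum>i<n. (cmod (if i = 0 then 1 else 0))\<^sup>2) = (\<Sum>i<n. if i = 0 then 1 else 0)"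
      by (intro sum.cong) auto
    also have "\<dots> = (1::real)" using n by simp
    finally have "(\<lambda>i. if i = 0 then 1 else 0) \<in> ?S" using n by simp
    then show ?thesis by (metis empty_iff)
  qed
  have mnz: "hform M (vec n f) \<noteq> 0" if "f \<in> ?S" for f using m[OF vf[OF that]] by simp
  note ch = continuous_on_hform_vec[OF M(1)] continuous_on_hform_vec[OF D(1)] continuous_on_hform_vec[OF K(1)]
  have "continuous_on ?S (\<lambda>f. lo (vec n f))" "continuous_on ?S (\<lambda>f. hi (vec n f))"
    unfolding lo_def hi_def s_def using mnz by (intro continuous_intros ch; simp)+
  from continuous_attains_sup[OF compact_vec_sphere ne this(1)]
    continuous_attains_inf[OF compact_vec_sphere ne this(2)]
  obtain f g where f: "f \<in> ?S" "\<forall>h\<in>?S. lo (vec n h) \<le> lo (vec n f)"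
    and g: "g \<in> ?S" "\<forall>h\<in>?S. hi (vec n g) \<le> hi (vec n h)"
    by (elim bexE)
  \<comment> \<open>Any point strictly between the largest \<open>lo\<close> and the smallest
    \<open>hi\<close> works; these extrema belong to possibly different vectors, which is why
    \<open>sep\<close> compares two vectors.\<close>
  obtain \<mu> where \<mu>: "lo (vec n f) < \<mu>" "\<mu> < hi (vec n g)"
    using dense[OF sep[OF vf[OF g(1)] vf[OF f(1)]]] by blast
  have unit: "hform (?P \<mu>) (vec n h) < 0" if h: "h \<in> ?S" for h
    unfolding fact[OF vf[OF h]] using bspec[OF f(2) h] bspec[OF g(2) h] \<mu> m[OF vf[OF h]]
    by (intro mult_pos_neg) auto
  have "hform (?P \<mu>) x < 0" if x: "x \<in> carrier_vec n" "x \<noteq> 0\<^sub>v n" for x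
  proof -
    \<comment> \<open>The form scales by the squared norm, so the sign on the sphere decides the
      sign everywhere.\<close>
    define r where "r = sqrt (\<Sum>i<n. (cmod (x $ i))\<^sup>2)"
    obtain i where i: "i < n" "x $ i \<noteq> 0" using x by (metis carrier_vecD eq_vecI index_zero_vec)
    have "(\<Sum>i<n. (cmod (x $ i))\<^sup>2) > 0" using i by (intro sum_pos2[of _ i]) auto
    then have r: "r > 0" "r\<^sup>2 = (\<Sum>i<n. (cmod (x $ i))\<^sup>2)" by (auto simp: r_def)
    define h where "h i = (if i < n then x $ i / of_real r else 0)" for i
    have "(\<Sum>i<n. (cmod (h i))\<^sup>2) = (\<Sum>i<n. (cmod (x $ i))\<^sup>2) / r\<^sup>2"
      unfolding sum_divide_distrib using r(1)
      by (intro sum.cong) (auto simp: h_def norm_divide power_divide)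
    also have "\<dots> = 1" unfolding r(2)[symmetric] using r(1) by simp
    finally have h: "h \<in> ?S" by (simp add: h_def)
    have "x = of_real r \<cdot>\<^sub>v vec n h" using x r(1) by (intro eq_vecI) (auto simp: h_def)
    then have "hform (?P \<mu>) x = r\<^sup>2 * hform (?P \<mu>) (vec n h)"
      using hform_smult[OF P(1) vf(1)[OF h], where c = "of_real r"] by simp
    also have "\<dots> < 0" using unit[OF h] r(1) by (intro mult_pos_neg) auto
    finally show ?thesis .
  qed
  then show ?thesis by blast
qed

section \<open>The pencil as a congruence transform\<close>

lemma mult_mat_zero_vec:
  fixes A :: "complex mat"
  shows "A \<in> carrier_mat n m \<Longrightarrow> A *\<^sub>v 0\<^sub>v m = 0\<^sub>v n"
  by (intro eq_vecI) auto

lemma zero_mat_mult_vec: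
  fixes x :: "complex vec"
  shows "x \<in> carrier_vec m \<Longrightarrow> 0\<^sub>m n m *\<^sub>v x = 0\<^sub>v n"
  by (intro eq_vecI) auto

text \<open>The invertible matrix \<open>mat_adjoint T\<close> maps the nonzero vectors onto the
  nonzero vectors, so both forms take the same values there.\<close>

lemma pos_def_congruence:
  assumes H: "H \<in> carrier_mat n n" "hermitian_mat H" and T: "T \<in> carrier_mat n n" "det T \<noteq> 0"
  shows "pos_def (T * H * mat_adjoint T) \<longleftrightarrow> pos_def H"
proof -
  let ?A = "mat_adjoint T" and ?H = "T * H * mat_adjoint T"
  have A: "?A \<in> carrier_mat n n" "det ?A \<noteq> 0" using T by (simp_all add: det_mat_adjoint[OF T(1)])
  have cH: "?H \<in> carrier_mat n n" using mult_carrier_mat[OF mult_carrier_mat[OF T(1) H(1)] A(1)] .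
  have q: "hform ?H x = hform H (?A *\<^sub>v x)" if "x \<in> carrier_vec n" for x
    using qform_congruence[OF T(1) H(1) that] by (simp add: hform_def)
  have nz: "?A *\<^sub>v x \<noteq> 0\<^sub>v n" if "x \<in> carrier_vec n" "x \<noteq> 0\<^sub>v n" for x
    using that A det_0_iff_vec_prod_zero_field[OF A(1)] by blast
  obtain B where B: "B \<in> carrier_mat n n" "?A * B = 1\<^sub>m n"
    using det_non_zero_imp_unit[OF A, where b = "()"] by (auto simp: Units_def ring_mat_def)
  have "\<exists>x\<in>carrier_vec n. x \<noteq> 0\<^sub>v n \<and> ?A *\<^sub>v x = y" if y: "y \<in> carrier_vec n" "y \<noteq> 0\<^sub>v n" for y
  proof -
    have "?A *\<^sub>v (B *\<^sub>v y) = y"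
      using assoc_mult_mat_vec[OF A(1) B(1) y(1)] B(2) y(1) by simp
    moreover from this have "B *\<^sub>v y \<noteq> 0\<^sub>v n"
      using y(2) mult_mat_zero_vec[OF A(1)] by metis
    moreover have "B *\<^sub>v y \<in> carrier_vec n" using B y by simp
    ultimately show ?thesis by blast
  qed
  then have "(\<forall>x\<in>carrier_vec n. x \<noteq> 0\<^sub>v n \<longrightarrow> 0 < hform H (?A *\<^sub>v x)) \<longleftrightarrow>
      (\<forall>y\<in>carrier_vec n. y \<noteq> 0\<^sub>v n \<longrightarrow> 0 < hform H y)"
    using nz mult_mat_vec_carrier[OF A(1)] by metis
  then show ?thesis
    using H hermitian_congruence[OF T(1) H] q by (simp add: pos_def_iff[OF cH] pos_def_iff[OF H(1)])
qed

lemma hform_four_block: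
  assumes A: "A \<in> carrier_mat n n" and B: "B \<in> carrier_mat n m" and C: "C \<in> carrier_mat m n"
    and D: "D \<in> carrier_mat m m" and x: "x \<in> carrier_vec n" and y: "y \<in> carrier_vec m"
  shows "hform (four_block_mat A B C D) (x @\<^sub>v y) =
    hform A x + Re ((B *\<^sub>v y) \<bullet>c x) + Re ((C *\<^sub>v x) \<bullet>c y) + hform D y"
proof -
  have c: "A *\<^sub>v x \<in> carrier_vec n" "B *\<^sub>v y \<in> carrier_vec n" "C *\<^sub>v x \<in> carrier_vec m"
    "D *\<^sub>v y \<in> carrier_vec m" "conjugate x \<in> carrier_vec n" "conjugate y \<in> carrier_vec m"
    using assms by auto
  have "conjugate (x @\<^sub>v y) = conjugate x @\<^sub>v conjugate y"
    using x y by (intro eq_vecI) auto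
  then have "qform (four_block_mat A B C D) (x @\<^sub>v y) =
      (A *\<^sub>v x + B *\<^sub>v y) \<bullet>c x + (C *\<^sub>v x + D *\<^sub>v y) \<bullet>c y"
    unfolding qform_def four_block_mat_mult_vec[OF A B C D x y]
    using c by (simp add: scalar_prod_append[of _ n _ m])
  also have "\<dots> = qform A x + (B *\<^sub>v y) \<bullet>c x + (C *\<^sub>v x) \<bullet>c y + qform D y"
    unfolding qform_def using c
    by (simp add: add_scalar_prod_distrib[of _ n] add_scalar_prod_distrib[of _ m])
  finally show ?thesis by (simp add: hform_def)
qed

lemma hform_zero: "H \<in> carrier_mat n n \<Longrightarrow> hform H (0\<^sub>v n) = 0"
  by (simp add: hform_def qform_def)

lemma append_vec_zero_iff:
  fixes x y :: "complex vec"
  assumes "x \<in> carrier_vec n" "y \<in> carrier_vec m"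
  shows "x @\<^sub>v y = 0\<^sub>v (n + m) \<longleftrightarrow> x = 0\<^sub>v n \<and> y = 0\<^sub>v m"
proof -
  have "0\<^sub>v (n + m) = (0\<^sub>v n @\<^sub>v 0\<^sub>v m :: complex vec)" by (intro eq_vecI) auto
  then show ?thesis by (simp only: append_vec_eq[OF assms(1) zero_carrier_vec])
qed

text \<open>Restricting the form to vectors with zero upper part isolates the lower right block. For
  the pencil this block is a multiple of the identity, whose sign restricts the admissible
  \<mu>.\<close>

lemma pos_def_lower_block:
  assumes "A \<in> carrier_mat n n" "B \<in> carrier_mat n m" "C \<in> carrier_mat m n" "D \<in> carrier_mat m m"
    and pd: "pos_def (four_block_mat A B C D)" and y: "y \<in> carrier_vec m" "y \<noteq> 0\<^sub>v m"
  shows "hform D y > 0"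
proof -
  have "0 < hform (four_block_mat A B C D) (0\<^sub>v n @\<^sub>v y)"
    using pd y append_vec_zero_iff[of "0\<^sub>v n" n y m] pos_def_iff[OF four_block_carrier_mat[OF assms(1,4)]]
    by auto
  also have "\<dots> = hform D y"
    using hform_four_block[OF assms(1-4) zero_carrier_vec y(1)] assms y
      mult_mat_vec_carrier[OF assms(2) y(1)]
    by (simp add: hform_zero mult_mat_zero_vec)
  finally show ?thesis .
qed

lemma hermitian_four_block_diag:
  assumes "A \<in> carrier_mat n n" "D \<in> carrier_mat m m" "hermitian_mat A" "hermitian_mat D"
  shows "hermitian_mat (four_block_mat A (0\<^sub>m n m) (0\<^sub>m m n) D)"
  using assms mat_adjoint_four_block[OF assms(1) zero_carrier_mat zero_carrier_mat assms(2)]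
  by (simp add: hermitian_mat_def)

lemma pos_def_four_block_diag:
  assumes A: "A \<in> carrier_mat n n" and D: "D \<in> carrier_mat m m"
    and hA: "hermitian_mat A" and hD: "hermitian_mat D"
  shows "pos_def (four_block_mat A (0\<^sub>m n m) (0\<^sub>m m n) D) \<longleftrightarrow> pos_def A \<and> pos_def D"
proof -
  let ?Q = "four_block_mat A (0\<^sub>m n m) (0\<^sub>m m n) D"
  have Q: "?Q \<in> carrier_mat (n + m) (n + m)" using A D by simp
  have q: "hform ?Q (x @\<^sub>v y) = hform A x + hform D y" if "x \<in> carrier_vec n" "y \<in> carrier_vec m" for x y
    using hform_four_block[OF A zero_carrier_mat zero_carrier_mat D that] that by (simp add: zero_mat_mult_vec)
  note z = append_vec_zero_iff
  show ?thesis
  proof (intro iffI conjI)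
    assume pd: "pos_def ?Q"
    have "0 < hform A x" if "x \<in> carrier_vec n" "x \<noteq> 0\<^sub>v n" for x
      using pd[unfolded pos_def_iff[OF Q]] q[of x "0\<^sub>v m"] z[of x n "0\<^sub>v m" m] that D
      by (auto simp: hform_zero dest!: bspec[of _ _ "x @\<^sub>v 0\<^sub>v m"])
    then show "pos_def A" using hA by (simp add: pos_def_iff[OF A])
    have "0 < hform D y" if "y \<in> carrier_vec m" "y \<noteq> 0\<^sub>v m" for y
      using pos_def_lower_block[OF A zero_carrier_mat zero_carrier_mat D pd that] .
    then show "pos_def D" using hD by (simp add: pos_def_iff[OF D])
  next
    assume pd: "pos_def A \<and> pos_def D"
    have "0 < hform ?Q v" if v: "v \<in> carrier_vec (n + m)" "v \<noteq> 0\<^sub>v (n + m)" for v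
    proof -
      obtain x y where xy: "x \<in> carrier_vec n" "y \<in> carrier_vec m" "v = x @\<^sub>v y"
        using v(1) by (metis vec_first_carrier vec_first_last_append vec_last_carrier)
      have "hform A x \<ge> 0" "x \<noteq> 0\<^sub>v n \<Longrightarrow> hform A x > 0"
        using pd xy A by (cases "x = 0\<^sub>v n"; auto simp: pos_def_iff[OF A] hform_zero less_imp_le)+
      moreover have "hform D y \<ge> 0" "y \<noteq> 0\<^sub>v m \<Longrightarrow> hform D y > 0"
        using pd xy D by (cases "y = 0\<^sub>v m"; auto simp: pos_def_iff[OF D] hform_zero less_imp_le)+
      moreover have "x \<noteq> 0\<^sub>v n \<or> y \<noteq> 0\<^sub>v m" using z[OF xy(1,2)] v(2) xy(3) by simp
      ultimately show ?thesis using q[OF xy(1,2)] xy(3) by (metis add_nonneg_pos add_pos_nonneg)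
    qed
    then show "pos_def ?Q"
      using hermitian_four_block_diag[OF A D hA hD] by (simp add: pos_def_iff[OF Q])
  qed
qed

text \<open>Block elimination of the lower right corner \<open>-\<mu> I\<close>, rescaled so that the Schur complement
  becomes \<open>\<sigma> P(\<mu>)\<close>; here \<open>\<sigma>\<close> is the sign of \<open>\<mu>\<close>, \<open>b = \<surd>\<bar>\<mu>\<bar>\<close> and \<open>c = 1 / b\<close>.\<close>

lemma pencil_congruence:
  fixes M D G :: "complex mat" and \<mu> \<sigma> b c :: real
  assumes M: "M \<in> carrier_mat n n" and D: "D \<in> carrier_mat n n" and G: "G \<in> carrier_mat n r"
    and \<sigma>: "\<sigma> * \<sigma> = 1" and cb: "c * b = 1" and b: "b * b = \<sigma> * \<mu>"
  defines "T \<equiv> four_block_mat (of_real c \<cdot>\<^sub>m 1\<^sub>m n) (of_real (- \<sigma> * c) \<cdot>\<^sub>m G) (0\<^sub>m r n) (of_real b \<cdot>\<^sub>m 1\<^sub>m r)"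
    and "Q \<equiv> four_block_mat (of_real \<sigma> \<cdot>\<^sub>m quad_matpoly M D (G * mat_adjoint G) (of_real \<mu>))
      (0\<^sub>m n r) (0\<^sub>m r n) (of_real (- \<sigma>) \<cdot>\<^sub>m 1\<^sub>m r)"
  shows "T \<in> carrier_mat (n + r) (n + r)" "det T \<noteq> 0"
    "pencil (four_block_mat D G (mat_adjoint G) (0\<^sub>m r r))
      (four_block_mat M (0\<^sub>m n r) (0\<^sub>m r n) (- 1\<^sub>m r)) (of_real \<mu>) = T * Q * mat_adjoint T"
proof -
  let ?A = "mat_adjoint G" and ?I = "1\<^sub>m n :: complex mat" and ?J = "1\<^sub>m r :: complex mat"
  let ?K = "G * ?A" and ?c = "of_real c :: complex" and ?b = "of_real b :: complex"
    and ?s = "of_real \<sigma> :: complex" and ?m = "of_real \<mu> :: complex"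
  let ?P = "quad_matpoly M D ?K ?m"
  have A: "?A \<in> carrier_mat r n" and K: "?K \<in> carrier_mat n n" using G by auto
  have P: "?P \<in> carrier_mat n n" using M D K by (simp add: quad_matpoly_def)
  show T: "T \<in> carrier_mat (n + r) (n + r)" by (simp add: T_def)
  have "c \<noteq> 0" "b \<noteq> 0" using cb by auto
  \<comment> \<open>\<open>T\<close> is block upper triangular with nonzero multiples of the
    identity on its diagonal.\<close>
  then show "det T \<noteq> 0"
    unfolding T_def using G by (subst det_four_block_mat_lower_left_zero[of _ n _ r]) auto
  have cc: "?c * ?b = 1" and ss: "?s * ?s = 1" and bb: "?b * ?b = ?s * ?m"
    using cb \<sigma> b by (metis of_real_1 of_real_mult)+
  \<comment> \<open>This identity normalises the upper left block, where the Schur complement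
    contributes the factor \<open>c * c * \<sigma>\<close> and the polynomial one further factor
    \<mu>.\<close>
  have ccsm: "?c * ?c * ?s * ?m = 1"
  proof -
    have "?c * ?c * ?s * ?m = ?c * ?c * (?b * ?b)" using bb by simp
    also have "\<dots> = (?c * ?b) * (?c * ?b)" by simp
    finally show ?thesis using cc by simp
  qed
  have "T * Q = four_block_mat ((?c * ?s) \<cdot>\<^sub>m ?P) (?c \<cdot>\<^sub>m G) (0\<^sub>m r n) ((- ?s * ?b) \<cdot>\<^sub>m ?J)"
  proof -
    have "(of_real (- \<sigma> * c) \<cdot>\<^sub>m G) * (of_real (- \<sigma>) \<cdot>\<^sub>m ?J) = ?c \<cdot>\<^sub>m G"
      using G ss by (intro eq_matI) (auto simp: mult_smult_distrib[of _ n r _ r] mult.assoc[symmetric] mult.commute[of _ ?c])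
    moreover have "(?c \<cdot>\<^sub>m ?I) * (?s \<cdot>\<^sub>m ?P) = (?c * ?s) \<cdot>\<^sub>m ?P"
      using P mult_smult_assoc_mat[of ?I n n "?s \<cdot>\<^sub>m ?P" n ?c] by (intro eq_matI) auto
    moreover have "(?b \<cdot>\<^sub>m ?J) * (of_real (- \<sigma>) \<cdot>\<^sub>m ?J) = (- ?s * ?b) \<cdot>\<^sub>m ?J"
      using mult_smult_assoc_mat[of ?J r r "of_real (- \<sigma>) \<cdot>\<^sub>m ?J" r ?b] by (intro eq_matI) auto
    ultimately show ?thesis
      unfolding T_def Q_def using G P
      by (subst mult_four_block_mat[of _ n n _ r _ r _ _ n _ r]) auto
  qed
  moreover have "mat_adjoint T = four_block_mat (?c \<cdot>\<^sub>m ?I) (0\<^sub>m n r) ((- ?s * ?c) \<cdot>\<^sub>m ?A) (?b \<cdot>\<^sub>m ?J)"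
    unfolding T_def using G by (subst mat_adjoint_four_block[of _ n n _ r _ r]) auto
  ultimately have "T * Q * mat_adjoint T =
      four_block_mat ((?c * ?s) \<cdot>\<^sub>m ?P) (?c \<cdot>\<^sub>m G) (0\<^sub>m r n) ((- ?s * ?b) \<cdot>\<^sub>m ?J) *
      four_block_mat (?c \<cdot>\<^sub>m ?I) (0\<^sub>m n r) ((- ?s * ?c) \<cdot>\<^sub>m ?A) (?b \<cdot>\<^sub>m ?J)" by simp
  also have "\<dots> = four_block_mat
      (((?c * ?s) \<cdot>\<^sub>m ?P) * (?c \<cdot>\<^sub>m ?I) + (?c \<cdot>\<^sub>m G) * ((- ?s * ?c) \<cdot>\<^sub>m ?A))
      (((?c * ?s) \<cdot>\<^sub>m ?P) * 0\<^sub>m n r + (?c \<cdot>\<^sub>m G) * (?b \<cdot>\<^sub>m ?J))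
      (0\<^sub>m r n * (?c \<cdot>\<^sub>m ?I) + ((- ?s * ?b) \<cdot>\<^sub>m ?J) * ((- ?s * ?c) \<cdot>\<^sub>m ?A))
      (0\<^sub>m r n * 0\<^sub>m n r + ((- ?s * ?b) \<cdot>\<^sub>m ?J) * (?b \<cdot>\<^sub>m ?J))"
    using P G A by (intro mult_four_block_mat) auto
  also have "\<dots> = four_block_mat (D + ?m \<cdot>\<^sub>m M) G ?A (- ?m \<cdot>\<^sub>m ?J)"
  proof (intro cong_four_block_mat)
    have "((?c * ?s) \<cdot>\<^sub>m ?P) * (?c \<cdot>\<^sub>m ?I) = (?c * ?c * ?s) \<cdot>\<^sub>m ?P"
      using P mult_smult_distrib[of "(?c * ?s) \<cdot>\<^sub>m ?P" n n ?I n ?c] by (intro eq_matI) auto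
    moreover have "(?c \<cdot>\<^sub>m G) * ((- ?s * ?c) \<cdot>\<^sub>m ?A) = (- ?c * ?c * ?s) \<cdot>\<^sub>m ?K"
      using G A mult_smult_distrib[of "?c \<cdot>\<^sub>m G" n r ?A n "- ?s * ?c"] mult_smult_assoc_mat[of G n r ?A n ?c]
      by (intro eq_matI) auto
    \<comment> \<open>The two multiples of \<open>L\<close>, which stands for
      \<open>G * mat_adjoint G\<close>, cancel; what remains is \<mu> times the pencil block, and
      \<open>ccsm\<close> removes the scalar.\<close>
    moreover have "(?c * ?c * ?s) \<cdot>\<^sub>m (?m\<^sup>2 \<cdot>\<^sub>m M + ?m \<cdot>\<^sub>m D + L) + (- ?c * ?c * ?s) \<cdot>\<^sub>m L = D + ?m \<cdot>\<^sub>m M"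
      if "L \<in> carrier_mat n n" for L
    proof -
      have "(?c * ?c * ?s) * (?m\<^sup>2 * u + ?m * v + w) + (- ?c * ?c * ?s) * w = v + ?m * u" for u v w
      proof -
        have "(?c * ?c * ?s) * (?m\<^sup>2 * u + ?m * v + w) + (- ?c * ?c * ?s) * w =
            (?c * ?c * ?s * ?m) * (?m * u + v)"
          by (simp add: power2_eq_square algebra_simps)
        then show ?thesis using ccsm by simp
      qed
      then show ?thesis using M D that by (intro eq_matI) simp_all
    qed
    ultimately show "((?c * ?s) \<cdot>\<^sub>m ?P) * (?c \<cdot>\<^sub>m ?I) + (?c \<cdot>\<^sub>m G) * ((- ?s * ?c) \<cdot>\<^sub>m ?A) = D + ?m \<cdot>\<^sub>m M"
      using K unfolding quad_matpoly_def by metis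
    show "((?c * ?s) \<cdot>\<^sub>m ?P) * 0\<^sub>m n r + (?c \<cdot>\<^sub>m G) * (?b \<cdot>\<^sub>m ?J) = G"
      using P G cc mult_smult_distrib[of "?c \<cdot>\<^sub>m G" n r ?J r ?b]
      by (intro eq_matI) (auto simp: mult.commute mult.assoc[symmetric])
    show "0\<^sub>m r n * (?c \<cdot>\<^sub>m ?I) + ((- ?s * ?b) \<cdot>\<^sub>m ?J) * ((- ?s * ?c) \<cdot>\<^sub>m ?A) = ?A"
    proof -
      have "(- ?s * ?b) * (- ?s * ?c) = (?s * ?s) * (?c * ?b)" by simp
      then have 1: "(- ?s * ?b) * (- ?s * ?c) = 1" using ss cc by simp
      have "((- ?s * ?b) \<cdot>\<^sub>m ?J) * ((- ?s * ?c) \<cdot>\<^sub>m ?A) = (- ?s * ?b) \<cdot>\<^sub>m ((- ?s * ?c) \<cdot>\<^sub>m ?A)"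
        using A mult_smult_assoc_mat[of ?J r r "(- ?s * ?c) \<cdot>\<^sub>m ?A" n "- ?s * ?b"]
          left_mult_one_mat[of "(- ?s * ?c) \<cdot>\<^sub>m ?A" r n] by simp
      also have "\<dots> = ((- ?s * ?b) * (- ?s * ?c)) \<cdot>\<^sub>m ?A" by (intro eq_matI) auto
      also have "\<dots> = ?A" unfolding 1 by (intro eq_matI) auto
      finally show ?thesis using A by simp
    qed
    have "(- ?s * ?b) * ?b = - ((?s * ?s) * ?m)" using bb by simp
    then have sbb: "(- ?s * ?b) * ?b = - ?m" using ss by simp
    show "0\<^sub>m r n * 0\<^sub>m n r + ((- ?s * ?b) \<cdot>\<^sub>m ?J) * (?b \<cdot>\<^sub>m ?J) = - ?m \<cdot>\<^sub>m ?J"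
    proof -
      have "((- ?s * ?b) \<cdot>\<^sub>m ?J) * (?b \<cdot>\<^sub>m ?J) = (- ?s * ?b) \<cdot>\<^sub>m (?b \<cdot>\<^sub>m ?J)"
        using mult_smult_assoc_mat[of ?J r r "?b \<cdot>\<^sub>m ?J" r "- ?s * ?b"]
          left_mult_one_mat[of "?b \<cdot>\<^sub>m ?J" r r] by simp
      also have "\<dots> = ((- ?s * ?b) * ?b) \<cdot>\<^sub>m ?J" by (intro eq_matI) auto
      finally show ?thesis unfolding sbb by simp
    qed
  qed
  also have "\<dots> = pencil (four_block_mat D G ?A (0\<^sub>m r r)) (four_block_mat M (0\<^sub>m n r) (0\<^sub>m r n) (- 1\<^sub>m r)) ?m"
    unfolding pencil_def using M D G by (intro eq_matI) auto
  finally show "pencil (four_block_mat D G ?A (0\<^sub>m r r))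
      (four_block_mat M (0\<^sub>m n r) (0\<^sub>m r n) (- 1\<^sub>m r)) ?m = T * Q * mat_adjoint T" ..
qed

text \<open>The sum shows that the form is nonnegative and also that it vanishes when
  \<open>r = 0\<close>; both facts are used below.\<close>

lemma hform_mult_adjoint:
  assumes G: "G \<in> carrier_mat n r" and x: "x \<in> carrier_vec n"
  shows "hform (G * mat_adjoint G) x = (\<Sum>i<r. (cmod ((mat_adjoint G *\<^sub>v x) $ i))\<^sup>2)"
proof -
  have A: "mat_adjoint G \<in> carrier_mat r n" using G by simp
  have y: "mat_adjoint G *\<^sub>v x \<in> carrier_vec r" using A x by simp
  have "qform (G * mat_adjoint G) x = (G *\<^sub>v (mat_adjoint G *\<^sub>v x)) \<bullet>c x"
    unfolding qform_def using assoc_mult_mat_vec[OF G A x] by simp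
  also have "\<dots> = of_real (\<Sum>i<r. (cmod ((mat_adjoint G *\<^sub>v x) $ i))\<^sup>2)"
    unfolding cscalar_prod_adjoint[OF G y x] by (rule cscalar_prod_self[OF y])
  finally show ?thesis by (simp only: hform_def Re_complex_of_real)
qed

section \<open>Hyperbolicity versus definiteness of the pencil, and the two inertia formulas\<close>

theorem theorem23:
  fixes n r :: nat and C M D G K A E :: "complex mat"
  assumes C: "C \<in> carrier_mat n n"
    and M: "M = C * mat_adjoint C" "pos_def M"
    and D: "D \<in> carrier_mat n n" "pos_def D"
    and G: "G \<in> carrier_mat n r" "vec_space.rank n G = r"
    and K: "K = G * mat_adjoint G"
    and A: "A = four_block_mat D G (mat_adjoint G) (0\<^sub>m r r)"
    and E: "E = four_block_mat M (0\<^sub>m n r) (0\<^sub>m r n) (- 1\<^sub>m r)"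
  shows "(hyperbolic n M D K \<longleftrightarrow> definite_pencil (n + r) A E) \<and>
    (\<forall>\<mu>::real. \<mu> > 0 \<longrightarrow>
       inertia (pencil A E (complex_of_real \<mu>)) =
         inertia (quad_matpoly M D K (complex_of_real \<mu>)) + (0, r, 0)) \<and>
    (\<forall>\<mu>::real. \<mu> < 0 \<longrightarrow>
       inertia (pencil A E (complex_of_real \<mu>)) =
         inertia (- quad_matpoly M D K (complex_of_real \<mu>)) + (r, 0, 0))"
proof -
  have Mc: "M \<in> carrier_mat n n" and Kc: "K \<in> carrier_mat n n" using M(1) C G(1) K by auto
  have hM: "hermitian_mat M" and m: "\<And>x. x \<in> carrier_vec n \<Longrightarrow> x \<noteq> 0\<^sub>v n \<Longrightarrow> hform M x > 0"
    using M(2) by (auto simp: pos_def_iff[OF Mc])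
  have hD: "hermitian_mat D" and d: "\<And>x. x \<in> carrier_vec n \<Longrightarrow> x \<noteq> 0\<^sub>v n \<Longrightarrow> hform D x > 0"
    using D(2) by (auto simp: pos_def_iff[OF D(1)])
  have hK: "hermitian_mat K"
    unfolding hermitian_mat_def K using mat_adjoint_mult[OF G(1) mat_adjoint_carrier[OF G(1)]] by simp
  have k: "hform K x = (\<Sum>i<r. (cmod ((mat_adjoint G *\<^sub>v x) $ i))\<^sup>2)" if "x \<in> carrier_vec n" for x
    unfolding K by (rule hform_mult_adjoint[OF G(1) that])
  let ?P = "\<lambda>\<mu>::real. quad_matpoly M D K (of_real \<mu>)"
  note P = hermitian_quad_matpoly[OF Mc D(1) Kc hM hD hK]
  note hP = hform_quad_matpoly[OF Mc D(1) Kc]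
  have Ac: "A \<in> carrier_mat (n + r) (n + r)" and Ec: "E \<in> carrier_mat (n + r) (n + r)"
    unfolding A E using Mc D(1) by simp_all
  have hA: "hermitian_mat A"
    unfolding hermitian_mat_def A
    using mat_adjoint_four_block[OF D(1) G(1) mat_adjoint_carrier[OF G(1)] zero_carrier_mat[of r r]] hD
    by (simp add: hermitian_mat_def)
  have J: "- 1\<^sub>m r \<in> carrier_mat r r" "hermitian_mat (- 1\<^sub>m r :: complex mat)"
    by (simp_all add: hermitian_mat_def)
  have hE: "hermitian_mat E"
    unfolding E by (rule hermitian_four_block_diag[OF Mc J(1) hM J(2)])
  let ?Q = "\<lambda>\<sigma> \<mu> :: real. four_block_mat (of_real \<sigma> \<cdot>\<^sub>m ?P \<mu>) (0\<^sub>m n r) (0\<^sub>m r n) (of_real (- \<sigma>) \<cdot>\<^sub>m 1\<^sub>m r)"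
  have sP: "of_real \<sigma> \<cdot>\<^sub>m ?P \<mu> \<in> carrier_mat n n" "hermitian_mat (of_real \<sigma> \<cdot>\<^sub>m ?P \<mu>)"
    and sJ: "of_real (- \<sigma>) \<cdot>\<^sub>m 1\<^sub>m r \<in> carrier_mat r r"
      "hermitian_mat (of_real (- \<sigma>) \<cdot>\<^sub>m 1\<^sub>m r)" for \<sigma> \<mu> :: real
    using P[of \<mu>] by (simp_all add: hermitian_mat_def)
  have Q: "?Q \<sigma> \<mu> \<in> carrier_mat (n + r) (n + r)" "hermitian_mat (?Q \<sigma> \<mu>)" for \<sigma> \<mu> :: real
    using four_block_carrier_mat[OF sP(1) sJ(1)] hermitian_four_block_diag[OF sP(1) sJ(1) sP(2) sJ(2)] by auto
  \<comment> \<open>The two conditions say that \<sigma> is the sign of a nonzero \<mu>, so the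
    square root of \<open>\<sigma> * \<mu>\<close> serves as the scaling.\<close>
  have congr: "\<exists>T\<in>carrier_mat (n + r) (n + r). det T \<noteq> 0 \<and>
      pencil A E (of_real \<mu>) = T * ?Q \<sigma> \<mu> * mat_adjoint T"
    if "\<sigma> * \<sigma> = 1" "\<sigma> * \<mu> > 0" for \<sigma> \<mu> :: real
  proof -
    have b: "1 / sqrt (\<sigma> * \<mu>) * sqrt (\<sigma> * \<mu>) = 1" "sqrt (\<sigma> * \<mu>) * sqrt (\<sigma> * \<mu>) = \<sigma> * \<mu>"
      using that by auto
    show ?thesis
      using pencil_congruence[OF Mc D(1) G(1) that(1) b] unfolding A E K by blast
  qed
  have inert: "inertia (pencil A E (of_real \<mu>)) =
      inertia (of_real \<sigma> \<cdot>\<^sub>m ?P \<mu>) + (if \<sigma> < 0 then r else 0, if \<sigma> > 0 then r else 0, 0)"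
    if \<sigma>: "\<sigma> * \<sigma> = 1" "\<sigma> * \<mu> > 0" for \<sigma> \<mu> :: real
  proof -
    obtain T where "T \<in> carrier_mat (n + r) (n + r)" "det T \<noteq> 0"
      "pencil A E (of_real \<mu>) = T * ?Q \<sigma> \<mu> * mat_adjoint T"
      using congr[OF \<sigma>] by blast
    then have "inertia (pencil A E (of_real \<mu>)) = inertia (?Q \<sigma> \<mu>)"
      using sylvester_inertia[OF Q] by simp
    also have "\<dots> = inertia (of_real \<sigma> \<cdot>\<^sub>m ?P \<mu>) + inertia (of_real (- \<sigma>) \<cdot>\<^sub>m 1\<^sub>m r)"
      by (rule inertia_four_block_diag[OF sP(1) sJ(1)])
    also have "inertia (of_real (- \<sigma>) \<cdot>\<^sub>m 1\<^sub>m r) = (if \<sigma> < 0 then r else 0, if \<sigma> > 0 then r else 0, 0)"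
      unfolding inertia_smult_one using \<sigma> by auto
    finally show ?thesis .
  qed
  have one: "of_real 1 \<cdot>\<^sub>m X = X" "of_real (- 1) \<cdot>\<^sub>m X = - X" for X :: "complex mat"
    by (intro eq_matI; simp)+
  \<comment> \<open>For negative \<mu> the lower block of the congruent matrix is the identity, so
    only the negated polynomial decides definiteness.\<close>
  have neg: "pos_def (pencil A E (of_real \<mu>)) \<longleftrightarrow>
      (\<forall>x\<in>carrier_vec n. x \<noteq> 0\<^sub>v n \<longrightarrow> hform (?P \<mu>) x < 0)" if "\<mu> < 0" for \<mu> :: real
  proof -
    have "(- 1) * (- 1) = (1 :: real)" "- 1 * \<mu> > 0" using that by auto
    from congr[OF this] obtain T where T: "T \<in> carrier_mat (n + r) (n + r)" "det T \<noteq> 0"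
      and pT: "pencil A E (of_real \<mu>) = T * ?Q (- 1) \<mu> * mat_adjoint T" by blast
    have "pos_def (pencil A E (of_real \<mu>)) \<longleftrightarrow> pos_def (?Q (- 1) \<mu>)"
      unfolding pT by (rule pos_def_congruence[OF Q T])
    also have "\<dots> \<longleftrightarrow> pos_def (- ?P \<mu>) \<and> pos_def (1\<^sub>m r)"
      using pos_def_four_block_diag[OF sP(1)[of "- 1" \<mu>] sJ(1)[of "- 1"] sP(2) sJ(2)]
      by (simp only: one minus_minus)
    finally have "pos_def (pencil A E (of_real \<mu>)) \<longleftrightarrow> pos_def (- ?P \<mu>) \<and> pos_def (1\<^sub>m r)" .
    moreover have "pos_def (1\<^sub>m r)"
    proof -
      have "0 < hform (1\<^sub>m r) y" if y: "y \<in> carrier_vec r" "y \<noteq> 0\<^sub>v r" for y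
      proof -
        have "0 < y \<bullet>c y" using y conjugate_square_greater_0_vec by blast
        then show ?thesis using y by (simp add: hform_def qform_def less_complex_def)
      qed
      then show ?thesis by (simp add: pos_def_iff[OF one_carrier_mat] hermitian_mat_def)
    qed
    ultimately show ?thesis
      using P[of \<mu>] by (simp add: pos_def_iff[of "- ?P \<mu>" n] hform_uminus[of _ n] hermitian_mat_def)
  qed
  have hyp: "hyperbolic n M D K \<longleftrightarrow> (\<forall>x\<in>carrier_vec n. x \<noteq> 0\<^sub>v n \<longrightarrow>
      0 < (hform D x)\<^sup>2 - 4 * hform M x * hform K x)"
  proof -
    have "0 < (qform D x)\<^sup>2 - 4 * qform M x * qform K x \<longleftrightarrow>
        0 < (hform D x)\<^sup>2 - 4 * hform M x * hform K x" if "x \<in> carrier_vec n" for x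
    proof -
      have "(qform D x)\<^sup>2 - 4 * qform M x * qform K x =
          of_real ((hform D x)\<^sup>2 - 4 * hform M x * hform K x)"
        using qform_hermitian[OF Mc hM that] qform_hermitian[OF D(1) hD that] qform_hermitian[OF Kc hK that]
        by simp
      then show ?thesis
        by (simp only: less_complex_def zero_complex.sel Re_complex_of_real Im_complex_of_real simp_thms)
    qed
    then show ?thesis
      unfolding hyperbolic_def using Mc D(1) Kc hM hD hK M(2) by simp
  qed
  have "definite_pencil (n + r) A E" if h: "hyperbolic n M D K"
  proof -
    have "\<exists>\<mu><0. \<forall>x\<in>carrier_vec n. x \<noteq> 0\<^sub>v n \<longrightarrow> hform (?P \<mu>) x < 0"
    proof (cases "n = 0")
      case True
      \<comment> \<open>For \<open>n = 0\<close> the condition is vacuous and any negative number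
        will do.\<close>
      then show ?thesis by (intro exI[of _ "- 1"]) auto
    next
      case False
      then obtain \<mu> where \<mu>: "\<forall>x\<in>carrier_vec n. x \<noteq> 0\<^sub>v n \<longrightarrow> hform (?P \<mu>) x < 0"
        using hyperbolic_negative_point[OF _ Mc hM D(1) hD Kc hK m] h[unfolded hyp] by blast
      define e :: "complex vec" where "e = unit_vec n 0"
      have e: "e \<in> carrier_vec n" "e \<noteq> 0\<^sub>v n" using False by (auto simp: e_def)
      have ke: "hform K e \<ge> 0" unfolding k[OF e(1)] by (intro sum_nonneg) auto
      \<comment> \<open>A single test vector suffices: for nonnegative \<mu> every term of the form
        at \<open>e\<close> is nonnegative.\<close>
      have "\<mu> < 0"
      proof (rule ccontr)
        assume "\<not> \<mu> < 0"
        then have "\<mu>\<^sup>2 * hform M e + \<mu> * hform D e + hform K e \<ge> 0"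
          using m[OF e] d[OF e] ke by (intro add_nonneg_nonneg mult_nonneg_nonneg) auto
        then show False using \<mu> e hP[OF e(1), of \<mu>] by force
      qed
      with \<mu> show ?thesis by blast
    qed
    then show ?thesis
      unfolding definite_pencil_def using Ac Ec hA hE neg by blast
  qed
  moreover have "hyperbolic n M D K" if h: "definite_pencil (n + r) A E"
  proof -
    from h consider (neg) \<mu> :: real where "\<mu> < 0" "pos_def (pencil A E (of_real \<mu>))"
      | (nonneg) \<mu> :: real where "\<mu> \<ge> 0" "pos_def (pencil A E (of_real \<mu>))" | (inf) "pos_def E"
      unfolding definite_pencil_def by (meson linorder_not_less)
    then show ?thesis
    proof cases
      case neg': neg
      have "0 < (hform D x)\<^sup>2 - 4 * hform M x * hform K x" if x: "x \<in> carrier_vec n" "x \<noteq> 0\<^sub>v n" for x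
      proof -
        \<comment> \<open>A real quadratic with positive leading coefficient and a negative value
          has positive discriminant; completing the square makes this explicit.\<close>
        have "hform (?P \<mu>) x < 0" using neg neg' x by blast
        then have "0 < - (4 * hform M x * hform (?P \<mu>) x)" using m[OF x] by (simp add: mult_pos_neg)
        also have "\<dots> \<le> (2 * \<mu> * hform M x + hform D x)\<^sup>2 - 4 * hform M x * hform (?P \<mu>) x" by simp
        also have "\<dots> = (hform D x)\<^sup>2 - 4 * hform M x * hform K x"
          unfolding hP[OF x(1)] by (simp add: power2_eq_square algebra_simps)
        finally show ?thesis .
      qed
      then show ?thesis using hyp by blast
    next
      case nonneg
      have eq: "pencil A E (of_real \<mu>) = four_block_mat (D + of_real \<mu> \<cdot>\<^sub>m M) G (mat_adjoint G) (of_real (- \<mu>) \<cdot>\<^sub>m 1\<^sub>m r)"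
        unfolding pencil_def A E using Mc D(1) G(1) by (intro eq_matI) auto
      have "r = 0"
      proof (rule ccontr)
        assume "r \<noteq> 0"
        define e :: "complex vec" where "e = unit_vec r 0"
        have e: "e \<in> carrier_vec r" "e \<noteq> 0\<^sub>v r" using \<open>r \<noteq> 0\<close> by (auto simp: e_def)
        have "0 < hform (of_real (- \<mu>) \<cdot>\<^sub>m 1\<^sub>m r) e"
          using pos_def_lower_block[OF _ G(1) mat_adjoint_carrier[OF G(1)] _ nonneg(2)[unfolded eq] e] Mc D(1)
          by simp
        also have "\<dots> = - \<mu> * Re (e \<bullet>c e)"
          using hform_smult_mat[OF one_carrier_mat e(1), of "- \<mu>"] e by (simp add: hform_def qform_def)
        also have "e \<bullet>c e = of_real (\<Sum>i<r. (cmod (e $ i))\<^sup>2)" by (rule cscalar_prod_self[OF e(1)])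
        also have "- \<mu> * Re (of_real (\<Sum>i<r. (cmod (e $ i))\<^sup>2)) \<le> 0"
          using nonneg(1) by (simp add: sum_nonneg mult_nonneg_nonneg)
        finally show False by simp
      qed
      \<comment> \<open>With \<open>r = 0\<close> the form of \<open>K\<close> vanishes and the
        discriminant reduces to the square of the positive form of \<open>D\<close>.\<close>
      then show ?thesis using hyp k d by force
    next
      case inf
      have "r = 0"
      proof (rule ccontr)
        assume "r \<noteq> 0"
        define e :: "complex vec" where "e = unit_vec r 0"
        have e: "e \<in> carrier_vec r" "e \<noteq> 0\<^sub>v r" using \<open>r \<noteq> 0\<close> by (auto simp: e_def)
        \<comment> \<open>The lower right block of \<open>E\<close> is minus the identity, which
          cannot be positive on a nonzero vector.\<close>
        have "0 < hform (- 1\<^sub>m r) e"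
          using pos_def_lower_block[OF Mc zero_carrier_mat zero_carrier_mat J(1) inf[unfolded E] e] .
        also have "\<dots> = - Re (e \<bullet>c e)"
          using hform_uminus[OF one_carrier_mat e(1)] e by (simp add: hform_def qform_def)
        also have "e \<bullet>c e = of_real (\<Sum>i<r. (cmod (e $ i))\<^sup>2)" by (rule cscalar_prod_self[OF e(1)])
        also have "- Re (of_real (\<Sum>i<r. (cmod (e $ i))\<^sup>2)) \<le> 0" by (simp add: sum_nonneg)
        finally show False by simp
      qed
      then show ?thesis using hyp k d by force
    qed
  qed
  moreover have "inertia (pencil A E (of_real \<mu>)) = inertia (?P \<mu>) + (0, r, 0)" if "\<mu> > 0" for \<mu>
    using inert[of 1 \<mu>] that by (simp only: one) simp
  moreover have "inertia (pencil A E (of_real \<mu>)) = inertia (- ?P \<mu>) + (r, 0, 0)" if "\<mu> < 0" for \<mu>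
    using inert[of "- 1" \<mu>] that by (simp only: one) simp
  ultimately show ?thesis by blast
qed

end
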